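(* For a dendrite $X$ the following are equivalent: (a) $\overline{E(X)}=X$; (b) $NC^*(X)$ is homeomorphic to $\mathbb{R}\setminus\mathbb{Q}$; (c) $NC^*(X)$ is zero-dimensional; (d) $NC^*(X)$ is totally disconnected.
   Context: A continuum is a compact connected metric space with more than one point; a subcontinuum of $X$ is a nonempty closed connected subset of $X$ (one-point sets are allowed). A dendroid is an arcwise connected, hereditarily unicoherent continuum; a dendrite is a locally connected dendroid. The order of a point $p$ in $X$ is the least cardinal $\kappa$ such that $p$ has arbitrarily small neighborhoods with boundary of cardinality $\leq\kappa$ (in a dendrite it equals the number of components of $X\setminus\{p\}$, being $\omega$ if this number is infinite); $E(X)$ is the set of points of order $1$. $C(X)$ is the set of all subcontinua of $X$, endowed with the Hausdorff metric (equivalently, the Vietoris topology), and $NC^*(X)=\{A\in C(X): X\setminus A \text{ is connected}\}$ with the subspace topology; the empty set counts as connected, so $X\in NC^*(X)$. A nonempty space is zero-dimensional if it has a base of clopen sets. A space is totally disconnected if any two distinct points can be separated by clopen subsets. *)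

theory Defs
  imports "HOL-Analysis.Analysis"
begin

unbundle cardinal_syntax

section \<open>Dendrites\<close>

text \<open>
  Spaces are values of type \<^typ>\<open>'a metric\<close>; purely topological notions are stated for
  \<^typ>\<open>'a topology\<close> and applied to \<^term>\<open>mtopology_of X\<close>.
\<close>

definition continuum :: "'a metric \<Rightarrow> bool" where
  "continuum X \<longleftrightarrow>
     compact_space (mtopology_of X) \<and> connected_space (mtopology_of X) \<and>
     (\<exists>x\<in>mspace X. \<exists>y\<in>mspace X. x \<noteq> y)"

definition subcontinua :: "'a topology \<Rightarrow> 'a set set" where
  "subcontinua T = {A. A \<noteq> {} \<and> closedin T A \<and> connectedin T A}"

definition arcwise_connected_space :: "'a topology \<Rightarrow> bool" where
  "arcwise_connected_space T \<longleftrightarrow>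
     (\<forall>x\<in>topspace T. \<forall>y\<in>topspace T. x \<noteq> y \<longrightarrow>
        (\<exists>g. embedding_map (top_of_set {0..1::real}) T g \<and> g 0 = x \<and> g 1 = y))"

definition unicoherent_space :: "'a topology \<Rightarrow> bool" where
  "unicoherent_space T \<longleftrightarrow>
     (\<forall>A\<in>subcontinua T. \<forall>B\<in>subcontinua T. A \<union> B = topspace T \<longrightarrow> connectedin T (A \<inter> B))"

definition hereditarily_unicoherent_space :: "'a topology \<Rightarrow> bool" where
  "hereditarily_unicoherent_space T \<longleftrightarrow>
     (\<forall>Y\<in>subcontinua T. unicoherent_space (subtopology T Y))"

definition dendroid :: "'a metric \<Rightarrow> bool" where
  "dendroid X \<longleftrightarrow>
     continuum X \<and> arcwise_connected_space (mtopology_of X) \<and>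
     hereditarily_unicoherent_space (mtopology_of X)"

definition dendrite :: "'a metric \<Rightarrow> bool" where
  "dendrite X \<longleftrightarrow> dendroid X \<and> locally_connected_space (mtopology_of X)"


section \<open>Order of a point and end points\<close>

text \<open>The cardinal \<open>\<kappa>\<close> is represented, as usual in HOL, by a minimal well-order.\<close>

definition order_at_most :: "'a topology \<Rightarrow> 'a \<Rightarrow> 'a rel \<Rightarrow> bool" where
  "order_at_most T p \<kappa> \<longleftrightarrow>
     (\<forall>U. openin T U \<and> p \<in> U \<longrightarrow>
        (\<exists>V. openin T V \<and> p \<in> V \<and> V \<subseteq> U \<and> |T frontier_of V| \<le>o \<kappa>))"

text \<open>
  \<open>\<kappa>\<close> is the least cardinal with this property. It suffices to compare with cardinals carried
  by subsets of \<^typ>\<open>'a\<close>, since boundaries are themselves such subsets.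
\<close>

definition has_order :: "'a topology \<Rightarrow> 'a \<Rightarrow> 'a rel \<Rightarrow> bool" where
  "has_order T p \<kappa> \<longleftrightarrow>
     Card_order \<kappa> \<and> order_at_most T p \<kappa> \<and>
     (\<forall>\<mu>. Card_order \<mu> \<and> order_at_most T p \<mu> \<longrightarrow> \<kappa> \<le>o \<mu>)"

text \<open>\<open>|{p}|\<close> is the cardinal one.\<close>

definition end_points :: "'a topology \<Rightarrow> 'a set" where
  "end_points T = {p \<in> topspace T. has_order T p |{p}| }"


section \<open>Hyperspaces\<close>

definition hausdorff_distance :: "'a metric \<Rightarrow> 'a set \<Rightarrow> 'a set \<Rightarrow> real" where
  "hausdorff_distance X A B =
     Inf {r. r > 0 \<and> A \<subseteq> (\<Union>b\<in>B. mball_of X b r) \<and> B \<subseteq> (\<Union>a\<in>A. mball_of X a r)}"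

text \<open>
  A value of type \<^typ>\<open>'a metric\<close> needs a distance function that is nonnegative on the whole
  type, while the infimum above is unspecified when no \<open>r\<close> qualifies; hence the value 0 outside
  the carrier.
\<close>

definition continuum_hyperspace :: "'a metric \<Rightarrow> 'a set metric" where
  "continuum_hyperspace X =
     metric (subcontinua (mtopology_of X),
             \<lambda>A B. if A \<in> subcontinua (mtopology_of X) \<and> B \<in> subcontinua (mtopology_of X)
                   then hausdorff_distance X A B else 0)"

text \<open>The empty set is \<^const>\<open>connectedin\<close>, so the whole space belongs to this set.\<close>

definition NC_star :: "'a metric \<Rightarrow> 'a set set" where
  "NC_star X =
     {A \<in> subcontinua (mtopology_of X). connectedin (mtopology_of X) (mspace X - A)}"

definition NC_star_space :: "'a metric \<Rightarrow> 'a set topology" where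
  "NC_star_space X = subtopology (mtopology_of (continuum_hyperspace X)) (NC_star X)"

lemma subcontinua_subset: "A \<in> subcontinua (mtopology_of X) \<Longrightarrow> A \<subseteq> mspace X"
  using closedin_subset[of "mtopology_of X" A] by (simp add: subcontinua_def)

lemma hausdorff_distance_commute: "hausdorff_distance X A B = hausdorff_distance X B A"
  unfolding hausdorff_distance_def by (rule arg_cong[where f = Inf]) auto

lemma hausdorff_distance_le:
  assumes "r > 0" "A \<subseteq> (\<Union>b\<in>B. mball_of X b r)" "B \<subseteq> (\<Union>a\<in>A. mball_of X a r)"
  shows "hausdorff_distance X A B \<le> r"
  unfolding hausdorff_distance_def
  using assms by (intro cInf_lower) (auto intro!: bdd_belowI[where m = 0])

lemma continuum_imp_bounded:
  assumes "continuum X"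
  obtains r where "r > 0" "\<And>x y. x \<in> mspace X \<Longrightarrow> y \<in> mspace X \<Longrightarrow> mdist X x y < r"
proof -
  interpret Metric_space "mspace X" "mdist X"
    by simp
  have "compactin mtopology (mspace X)"
    using assms unfolding continuum_def compact_space_def mtopology_of_def by simp
  then have "mbounded (mspace X)"
    by (rule compactin_imp_mbounded)
  then obtain B where "B > 0" "\<forall>x\<in>mspace X. \<forall>y\<in>mspace X. mdist X x y \<le> B"
    unfolding mbounded_alt_pos by blast
  then show thesis
    by (intro that[of "B + 1"]) force+
qed

lemma hausdorff_distance_witness:
  assumes X: "continuum X" and A: "A \<in> subcontinua (mtopology_of X)"
    and B: "B \<in> subcontinua (mtopology_of X)" and less: "hausdorff_distance X A B < e"
  obtains r where "0 < r" "r < e" "A \<subseteq> (\<Union>b\<in>B. mball_of X b r)" "B \<subseteq> (\<Union>a\<in>A. mball_of X a r)"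
proof -
  let ?R = "{r. r > 0 \<and> A \<subseteq> (\<Union>b\<in>B. mball_of X b r) \<and> B \<subseteq> (\<Union>a\<in>A. mball_of X a r)}"
  obtain r where r: "r > 0" "\<And>x y. x \<in> mspace X \<Longrightarrow> y \<in> mspace X \<Longrightarrow> mdist X x y < r"
    using continuum_imp_bounded[OF X] by blast
  have sub: "A \<subseteq> mspace X" "B \<subseteq> mspace X"
    using A B by (auto dest: subcontinua_subset)
  obtain a b where ab: "a \<in> A" "b \<in> B"
    using A B unfolding subcontinua_def by auto
  have "A \<subseteq> mball_of X b r" "B \<subseteq> mball_of X a r"
    using sub ab r(2) by (auto simp: subset_iff)
  then have "A \<subseteq> (\<Union>b\<in>B. mball_of X b r)" "B \<subseteq> (\<Union>a\<in>A. mball_of X a r)"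
    using ab by blast+
  then have "r \<in> ?R"
    using r(1) by blast
  then have "?R \<noteq> {}"
    by blast
  from cInf_lessD[OF this less[unfolded hausdorff_distance_def]] show thesis
    using that by blast
qed

lemma hausdorff_distance_nonneg:
  assumes X: "continuum X" and A: "A \<in> subcontinua (mtopology_of X)"
    and B: "B \<in> subcontinua (mtopology_of X)"
  shows "0 \<le> hausdorff_distance X A B"
  using hausdorff_distance_witness[OF X A B, of 0] by force

lemma hausdorff_distance_eq_0_imp_subset:
  assumes X: "continuum X" and A: "A \<in> subcontinua (mtopology_of X)"
    and B: "B \<in> subcontinua (mtopology_of X)" and 0: "hausdorff_distance X A B = 0"
  shows "A \<subseteq> B"
proof
  interpret Metric_space "mspace X" "mdist X"
    by simp
  fix x assume x: "x \<in> A"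
  have "\<exists>y\<in>B. y \<in> mball x e" if "e > 0" for e
  proof -
    have "hausdorff_distance X A B < e"
      using 0 that by simp
    then obtain r where "r < e" "A \<subseteq> (\<Union>b\<in>B. mball_of X b r)"
      by (rule hausdorff_distance_witness[OF X A B])
    then obtain y where "y \<in> B" "x \<in> mball_of X y r"
      using x by blast
    then show ?thesis
      using \<open>r < e\<close> by (auto simp: commute intro!: bexI[of _ y])
  qed
  then have "x \<in> mtopology closure_of B"
    using x subcontinua_subset[OF A] by (auto simp: metric_closure_of)
  moreover have "closedin mtopology B"
    using B by (simp add: subcontinua_def mtopology_of_def)
  ultimately show "x \<in> B"
    by (simp add: closure_of_closedin)
qed

lemma hausdorff_distance_triangle:
  assumes X: "continuum X" and A: "A \<in> subcontinua (mtopology_of X)"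
    and B: "B \<in> subcontinua (mtopology_of X)" and C: "C \<in> subcontinua (mtopology_of X)"
  shows "hausdorff_distance X A C \<le> hausdorff_distance X A B + hausdorff_distance X B C"
proof (rule field_le_epsilon)
  fix e :: real assume "e > 0"
  obtain r where r: "0 < r" "r < hausdorff_distance X A B + e / 2"
      "A \<subseteq> (\<Union>b\<in>B. mball_of X b r)" "B \<subseteq> (\<Union>a\<in>A. mball_of X a r)"
    using hausdorff_distance_witness[OF X A B, of "hausdorff_distance X A B + e / 2"] \<open>e > 0\<close>
    by auto
  obtain s where s: "0 < s" "s < hausdorff_distance X B C + e / 2"
      "B \<subseteq> (\<Union>c\<in>C. mball_of X c s)" "C \<subseteq> (\<Union>b\<in>B. mball_of X b s)"
    using hausdorff_distance_witness[OF X B C, of "hausdorff_distance X B C + e / 2"] \<open>e > 0\<close>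
    by auto
  have step: "P \<subseteq> (\<Union>z\<in>R. mball_of X z (u + v))"
    if P: "P \<subseteq> (\<Union>y\<in>Q. mball_of X y u)" and Q: "Q \<subseteq> (\<Union>z\<in>R. mball_of X z v)"
    for P Q R u v
  proof
    fix x assume "x \<in> P"
    then obtain y where y: "y \<in> Q" "x \<in> mball_of X y u"
      using P by blast
    then obtain z where z: "z \<in> R" "y \<in> mball_of X z v"
      using Q by blast
    have "x \<in> mball_of X z (u + v)"
      using y z mdist_triangle[of z X y x] by auto
    with z show "x \<in> (\<Union>z\<in>R. mball_of X z (u + v))"
      by blast
  qed
  have "hausdorff_distance X A C \<le> r + s"
    using step[OF r(3) s(3)] step[OF s(4) r(4)] r(1) s(1)
    by (intro hausdorff_distance_le) (auto simp: add.commute)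
  then show "hausdorff_distance X A C \<le> hausdorff_distance X A B + hausdorff_distance X B C + e"
    using r(2) s(2) by linarith
qed

lemma Metric_space_hausdorff_distance:
  assumes X: "continuum X"
  shows "Metric_space (subcontinua (mtopology_of X))
           (\<lambda>A B. if A \<in> subcontinua (mtopology_of X) \<and> B \<in> subcontinua (mtopology_of X)
                  then hausdorff_distance X A B else 0)"
proof (unfold_locales, goal_cases)
  case (1 A B)
  then show ?case using hausdorff_distance_nonneg[OF X] by auto
next
  case (2 A B)
  then show ?case by (auto simp: hausdorff_distance_commute)
next
  case (3 A B)
  have "hausdorff_distance X A A = 0"
  proof (rule antisym)
    show "hausdorff_distance X A A \<le> 0"
    proof (rule field_le_epsilon)
      fix e :: real assume "e > 0"
      have "a \<in> mball_of X a e" if "a \<in> A" for a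
      proof -
        have a: "a \<in> mspace X"
          using subcontinua_subset[OF 3(1)] that by blast
        then have "mdist X a a = 0"
          by (rule mdist_zero[THEN iffD2, OF _ _ refl]) (rule a)
        with a \<open>e > 0\<close> show ?thesis
          unfolding in_mball_of by metis
      qed
      then have "A \<subseteq> (\<Union>a\<in>A. mball_of X a e)"
        by blast
      with \<open>e > 0\<close> show "hausdorff_distance X A A \<le> 0 + e"
        using hausdorff_distance_le[where r = e and A = A and B = A and X = X] by simp
    qed
  qed (use hausdorff_distance_nonneg[OF X 3(1) 3(1)] in simp)
  moreover have "A = B" if "hausdorff_distance X A B = 0"
    using hausdorff_distance_eq_0_imp_subset[OF X 3(1) 3(2)]
      hausdorff_distance_eq_0_imp_subset[OF X 3(2) 3(1)] that
    by (simp add: hausdorff_distance_commute subset_antisym)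
  ultimately show ?case using 3 by auto
next
  case (4 A B C)
  then show ?case using hausdorff_distance_triangle[OF X] by simp
qed

lemma mspace_continuum_hyperspace:
  "continuum X \<Longrightarrow> mspace (continuum_hyperspace X) = subcontinua (mtopology_of X)"
  unfolding continuum_hyperspace_def
  by (rule Metric_space.mspace_metric[OF Metric_space_hausdorff_distance])

lemma mdist_continuum_hyperspace:
  "continuum X \<Longrightarrow> A \<in> subcontinua (mtopology_of X) \<Longrightarrow> B \<in> subcontinua (mtopology_of X) \<Longrightarrow>
     mdist (continuum_hyperspace X) A B = hausdorff_distance X A B"
  unfolding continuum_hyperspace_def
  by (simp add: Metric_space.mdist_metric[OF Metric_space_hausdorff_distance])

lemma topspace_NC_star_space: "continuum X \<Longrightarrow> topspace (NC_star_space X) = NC_star X"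
  unfolding NC_star_space_def by (auto simp: mspace_continuum_hyperspace NC_star_def)


section \<open>Disconnectedness properties\<close>

definition zero_dimensional_space :: "'a topology \<Rightarrow> bool" where
  "zero_dimensional_space T \<longleftrightarrow>
     topspace T \<noteq> {} \<and>
     (\<exists>\<B>. (\<forall>B\<in>\<B>. openin T B \<and> closedin T B) \<and> openin T = arbitrary union_of (\<lambda>B. B \<in> \<B>))"

definition totally_disconnected_space :: "'a topology \<Rightarrow> bool" where
  "totally_disconnected_space T \<longleftrightarrow>
     (\<forall>x\<in>topspace T. \<forall>y\<in>topspace T. x \<noteq> y \<longrightarrow>
        (\<exists>U. openin T U \<and> closedin T U \<and> x \<in> U \<and> y \<notin> U))"

end

theory Submission
  imports Defs
begin

text \<open>
  Let \<open>X\<close> be a dendrite. If \<open>A \<noteq> X\<close> is a subcontinuum with connected complement, then the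
  boundary of \<open>A\<close> is a single point \<open>p\<close>: two boundary points could be joined inside \<open>A\<close> and also
  through the complement, and arcs in \<open>X\<close> are unique. Hence \<open>A\<close> is \<open>X\<close> minus one component of
  \<open>X - {p}\<close> (\<open>connected_co_connected_eq\<close>), and the space in question is a space of cuts of \<open>X\<close>.

  Call a point branching if its complement has at least three components. The whole equivalence
  passes through one condition on \<open>X\<close>, called \<open>arcwise_dense_branching\<close> below: every arc contains
  a branching point different from its two ends.

  The condition implies that the space is homeomorphic to the irrationals. If \<open>b\<close> is branching,
  then containing \<open>b\<close> is a clopen property of \<open>A\<close>: a connected complement that misses \<open>b\<close> meets
  only one component of \<open>X - {b}\<close>, so \<open>A\<close> meets two of them, and any connected set that meets two
  of them contains \<open>b\<close>. Enough branching points turn such conditions into a base of clopen sets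
  (\<open>zero_dimensional_N\<close>). A basic set consists of cuts that lie on a fixed side of some branching
  point \<open>b\<close>; cuts that approach \<open>b\<close> along an arc do not converge to a cut, which rules out compact
  open sets (\<open>open_N_not_compact\<close>). The space is also a \<open>G\<^sub>\<delta>\<close> in the compact metrizable hyperspace
  of all subcontinua (\<open>completely_metrizable_N\<close>). By the theorem of Alexandrov and Urysohn
  (\<open>homeomorphic_baire_space\<close>) a Polish zero-dimensional space without nonempty compact open subsets
  is the Baire space, and the irrationals are another such space.

  Conversely, cutting \<open>X\<close> at a point that moves along an arc without interior branching points
  gives a nonconstant continuous path of members, so a totally disconnected space of cuts forces
  the condition (\<open>totally_disconnected_imp_arcwise_dense_branching\<close>).

  Finally the condition is equivalent to density of the end points. An arc without interior
  branching points is open in \<open>X\<close> apart from its two ends, and an interior point of an arc is not an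
  end point. In the other direction, the components hanging off a short arc at its branching points
  are eventually small, so every open set contains a component of some \<open>X - {b}\<close>; nesting such
  components with diameters tending to zero produces an end point.
\<close>

section \<open>Zero-dimensional spaces\<close>

lemma zero_dimensional_space_alt:
  "zero_dimensional_space T \<longleftrightarrow> topspace T \<noteq> {} \<and>
     (\<forall>V x. openin T V \<and> x \<in> V \<longrightarrow> (\<exists>W. openin T W \<and> closedin T W \<and> x \<in> W \<and> W \<subseteq> V))"
    (is "_ \<longleftrightarrow> _ \<and> ?base")
proof -
  have "(\<exists>\<B>. (\<forall>B\<in>\<B>. openin T B \<and> closedin T B) \<and> openin T = arbitrary union_of (\<lambda>B. B \<in> \<B>)) \<longleftrightarrow> ?base"
  proof
    assume "\<exists>\<B>. (\<forall>B\<in>\<B>. openin T B \<and> closedin T B) \<and> openin T = arbitrary union_of (\<lambda>B. B \<in> \<B>)"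
    then show ?base
      unfolding openin_topology_base_unique by blast
  next
    assume ?base
    then show "\<exists>\<B>. (\<forall>B\<in>\<B>. openin T B \<and> closedin T B) \<and> openin T = arbitrary union_of (\<lambda>B. B \<in> \<B>)"
      by (intro exI[of _ "{B. openin T B \<and> closedin T B}"])
         (auto simp: openin_topology_base_unique)
  qed
  then show ?thesis
    unfolding zero_dimensional_space_def by simp
qed

lemma zero_dimensional_space_homeomorphic:
  assumes "S homeomorphic_space T" "zero_dimensional_space T"
  shows "zero_dimensional_space S"
proof -
  obtain f g where fg: "homeomorphic_maps S T f g"
    using assms(1) unfolding homeomorphic_space_def by blast
  then have cf: "continuous_map S T f" and cg: "continuous_map T S g"
    and gf: "\<And>x. x \<in> topspace S \<Longrightarrow> g (f x) = x"
    unfolding homeomorphic_maps_def by auto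
  have "\<exists>W. openin S W \<and> closedin S W \<and> x \<in> W \<and> W \<subseteq> V" if V: "openin S V" "x \<in> V" for V x
  proof -
    have x: "x \<in> topspace S"
      using V openin_subset by blast
    have "openin T {y \<in> topspace T. g y \<in> V}"
      using cg V(1) by (rule openin_continuous_map_preimage)
    moreover have "f x \<in> {y \<in> topspace T. g y \<in> V}"
      using x gf V(2) cf unfolding continuous_map_def by auto
    ultimately have "\<exists>W. openin T W \<and> closedin T W \<and> f x \<in> W \<and> W \<subseteq> {y \<in> topspace T. g y \<in> V}"
      using assms(2)[unfolded zero_dimensional_space_alt, THEN conjunct2, rule_format] by blast
    then obtain W where W: "openin T W" "closedin T W" "f x \<in> W" "W \<subseteq> {y \<in> topspace T. g y \<in> V}"
      by blast
    let ?W = "{x \<in> topspace S. f x \<in> W}"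
    have "openin S ?W" "closedin S ?W"
      using cf W(1,2) openin_continuous_map_preimage closedin_continuous_map_preimage by blast+
    moreover have "?W \<subseteq> V"
      using W(4) gf by force
    ultimately show ?thesis
      using x W(3) by blast
  qed
  moreover have "topspace S \<noteq> {}"
    using assms homeomorphic_empty_space_eq unfolding zero_dimensional_space_def
    by (metis homeomorphic_empty_space topspace_discrete_topology null_topspace_iff_trivial)
  ultimately show ?thesis
    unfolding zero_dimensional_space_alt by blast
qed

lemma zero_dimensional_imp_totally_disconnected_space:
  assumes "zero_dimensional_space T" "t1_space T"
  shows "totally_disconnected_space T"
  unfolding totally_disconnected_space_def
proof (intro ballI impI)
  fix x y assume xy: "x \<in> topspace T" "y \<in> topspace T" "x \<noteq> y"
  then obtain V where "openin T V" "x \<in> V" "y \<notin> V"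
    using assms(2) unfolding t1_space_def by blast
  then obtain W where "openin T W" "closedin T W" "x \<in> W" "W \<subseteq> V"
    using assms(1) unfolding zero_dimensional_space_alt by metis
  then show "\<exists>U. openin T U \<and> closedin T U \<and> x \<in> U \<and> y \<notin> U"
    using \<open>y \<notin> V\<close> by blast
qed

section \<open>The Alexandrov-Urysohn characterization of the irrationals\<close>

abbreviation baire_space :: "(nat \<Rightarrow> nat) topology" where
  "baire_space \<equiv> product_topology (\<lambda>_. discrete_topology UNIV) UNIV"

text \<open>
  A clopen set that is not compact breaks up into infinitely many small clopen pieces: refine an
  open cover without finite subcover by small clopen sets, extract a countable subcover and make it
  disjoint. If only finitely many pieces remained nonempty, they would lead to a finite subcover.
\<close>

lemma (in Metric_space) noncompact_clopen_split:
  assumes sc: "second_countable mtopology" and zd: "zero_dimensional_space mtopology"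
    and U: "openin mtopology U" "closedin mtopology U" "\<not> compactin mtopology U" and e: "e > 0"
  obtains P :: "nat \<Rightarrow> 'a set" where
    "\<And>n. openin mtopology (P n)" "\<And>n. closedin mtopology (P n)" "\<And>n. P n \<noteq> {}"
    "disjoint_family P" "(\<Union>n. P n) = U" "\<And>n. \<exists>a. P n \<subseteq> mcball a e"
proof -
  have "U \<subseteq> M"
    using U(1) openin_subset by fastforce
  then obtain \<C> where \<C>: "\<And>C. C \<in> \<C> \<Longrightarrow> openin mtopology C" "U \<subseteq> \<Union>\<C>"
    and nofin: "\<And>\<F>. finite \<F> \<Longrightarrow> \<F> \<subseteq> \<C> \<Longrightarrow> \<not> U \<subseteq> \<Union>\<F>"
    using U(3) unfolding compactin_def topspace_mtopology by metis
  define \<B> where "\<B> = {B. openin mtopology B \<and> closedin mtopology B \<and> B \<subseteq> U \<and>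
      (\<exists>a. B \<subseteq> mcball a e) \<and> (\<exists>C\<in>\<C>. B \<subseteq> C)}"
  have cover: "\<exists>B\<in>\<B>. x \<in> B" if x: "x \<in> U" for x
  proof -
    obtain C where C: "C \<in> \<C>" "x \<in> C"
      using \<C>(2) x by blast
    have "openin mtopology (U \<inter> C \<inter> mball x e)" "x \<in> U \<inter> C \<inter> mball x e"
      using U(1) \<C>(1)[OF C(1)] C(2) x e \<open>U \<subseteq> M\<close> by auto
    then obtain W where "openin mtopology W" "closedin mtopology W" "x \<in> W" "W \<subseteq> U \<inter> C \<inter> mball x e"
      using zd unfolding zero_dimensional_space_alt by metis
    moreover from this have "W \<subseteq> mcball x e"
      using mball_subset_mcball by blast
    ultimately show ?thesis
      unfolding \<B>_def using C by blast
  qed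
  obtain \<V> where \<V>: "countable \<V>" "\<V> \<subseteq> insert (M - U) \<B>" "\<Union>\<V> = M"
  proof -
    have "Lindelof_space mtopology"
      by (rule second_countable_imp_Lindelof_space[OF sc])
    moreover have "openin mtopology B" if "B \<in> insert (M - U) \<B>" for B
      using that U(2) unfolding \<B>_def by (auto simp: closedin_def)
    moreover have "\<Union>(insert (M - U) \<B>) = topspace mtopology"
      using cover \<open>U \<subseteq> M\<close> unfolding \<B>_def by fastforce
    ultimately show thesis
      using that by (metis (no_types, lifting) Lindelof_spaceD topspace_mtopology)
  qed
  have "U \<subseteq> \<Union>\<V>"
    using \<V>(3) \<open>U \<subseteq> M\<close> by simp
  define \<B>' where "\<B>' = \<V> \<inter> \<B>"
  have "U \<subseteq> \<Union>\<B>'" "countable \<B>'" "\<B>' \<subseteq> \<B>"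
    using \<V>(1,2) \<open>U \<subseteq> \<Union>\<V>\<close> unfolding \<B>'_def by blast+
  moreover have "U \<noteq> {}"
    using U(3) by auto
  ultimately have "\<B>' \<noteq> {}"
    by blast
  define B where "B = from_nat_into \<B>'"
  have rB: "range B = \<B>'"
    unfolding B_def by (rule range_from_nat_into) fact+
  then have B: "B n \<in> \<B>" for n
    using \<open>\<B>' \<subseteq> \<B>\<close> by blast
  have UB: "U = (\<Union>n. B n)"
    using rB \<open>U \<subseteq> \<Union>\<B>'\<close> B unfolding \<B>_def by blast
  define D where "D = disjointed B"
  have UD: "(\<Union>n. D n) = U"
    unfolding D_def UN_disjointed_eq UB ..
  have clopen: "openin mtopology (D n) \<and> closedin mtopology (D n)" for n
  proof -
    have "openin mtopology (\<Union>i\<in>{0..<n}. B i)" "closedin mtopology (\<Union>i\<in>{0..<n}. B i)"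
      using B by (auto simp: \<B>_def intro!: closedin_Union)
    then show ?thesis
      using B[of n] unfolding D_def disjointed_def
      by (simp add: \<B>_def openin_diff closedin_diff)
  qed
  define N where "N = {n. D n \<noteq> {}}"
  have "infinite N"
  proof
    assume "finite N"
    have "\<exists>C\<in>\<C>. B n \<subseteq> C" for n
      using B[of n] unfolding \<B>_def by blast
    then obtain C where C: "\<And>n. C n \<in> \<C>" "\<And>n. B n \<subseteq> C n"
      by metis
    have "U \<subseteq> \<Union>(C ` N)"
    proof
      fix x assume "x \<in> U"
      then obtain n where "x \<in> D n"
        using UD by blast
      then show "x \<in> \<Union>(C ` N)"
        using C(2)[of n] disjointed_subset[of B n] unfolding N_def D_def by blast
    qed
    then show False
      using nofin[of "C ` N"] \<open>finite N\<close> C(1) by blast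
  qed
  show thesis
  proof (rule that[of "\<lambda>k. D (enumerate N k)"])
    show "D (enumerate N n) \<noteq> {}" for n
      using enumerate_in_set[OF \<open>infinite N\<close>] unfolding N_def by blast
    show "disjoint_family (\<lambda>k. D (enumerate N k))"
      using disjoint_family_disjointed[of B] inj_enumerate[OF \<open>infinite N\<close>]
      unfolding disjoint_family_on_def D_def by (metis UNIV_I injD)
    show "(\<Union>n. D (enumerate N n)) = U"
    proof -
      have "U = (\<Union>n\<in>N. D n)"
        using UD unfolding N_def by blast
      also have "\<dots> = (\<Union>n\<in>range (enumerate N). D n)"
        by (simp add: range_enumerate[OF \<open>infinite N\<close>])
      also have "\<dots> = (\<Union>n. D (enumerate N n))"
        by simp
      finally show ?thesis ..
    qed
    show "\<exists>a. D (enumerate N n) \<subseteq> mcball a e" for n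
      using B[of "enumerate N n"] disjointed_subset[of B "enumerate N n"]
      unfolding \<B>_def D_def by blast
  qed (use clopen in auto)
qed

text \<open>
  Iterated splitting assigns to each sequence of naturals a decreasing sequence of nonempty clopen
  sets whose diameters tend to zero. Completeness makes it shrink to one point. Sequences agreeing up
  to \<open>n\<close> give points in the same piece of level \<open>n\<close>, and the pieces of one level are disjoint and
  open, so this bijection is continuous in both directions.
\<close>

theorem homeomorphic_baire_space:
  fixes T :: "'a topology"
  assumes cm: "completely_metrizable_space T" and sc: "second_countable T"
    and zd: "zero_dimensional_space T"
    and nc: "\<And>U. openin T U \<Longrightarrow> U \<noteq> {} \<Longrightarrow> \<not> compactin T U"
  shows "T homeomorphic_space baire_space"
proof -
  obtain M d where M: "Metric_space M d" "Metric_space.mcomplete M d" and T: "T = Metric_space.mtopology M d"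
    using cm unfolding completely_metrizable_space_def by blast
  interpret Metric_space M d
    by (rule M(1))
  let ?clo = "\<lambda>U. openin T U \<and> closedin T U \<and> U \<noteq> {}"
  define good where "good U e P \<longleftrightarrow> (\<forall>n. ?clo (P n)) \<and> disjoint_family P \<and>
      (\<Union>n::nat. P n) = U \<and> (\<forall>n. \<exists>a. P n \<subseteq> mcball a e)" for U e P
  have "\<exists>P. good U e P" if U: "?clo U" "e > 0" for U e
  proof -
    have "openin mtopology U" "closedin mtopology U" "\<not> compactin mtopology U"
      using U(1) nc[of U] T by auto
    then show ?thesis
      by (rule noncompact_clopen_split[OF sc[unfolded T] zd[unfolded T] _ _ _ U(2)])
         (simp add: T good_def, blast)
  qed
  moreover define P where "P U e = (SOME P. good U e P)" for U e
  ultimately have good: "good U e (P U e)" if "?clo U" "e > 0" for U e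
    using that someI_ex[of "good U e"] by metis
  note P = good[unfolded good_def, THEN conjunct1, rule_format]
    good[unfolded good_def, THEN conjunct2, THEN conjunct1]
    good[unfolded good_def, THEN conjunct2, THEN conjunct2, THEN conjunct1]
    good[unfolded good_def, THEN conjunct2, THEN conjunct2, THEN conjunct2, rule_format]
  \<comment> \<open>the pieces of level \<open>n + 1\<close> have radius at most \<open>r n\<close>\<close>
  define r where "r n = inverse (real (Suc n))" for n
  have r: "r n > 0" for n
    unfolding r_def by simp
  define S where "S f = rec_nat M (\<lambda>n U. P U (r n) (f n))" for f :: "nat \<Rightarrow> nat"
  have S0: "S f 0 = M" and SS: "S f (Suc n) = P (S f n) (r n) (f n)" for f n
    unfolding S_def by simp_all
  have "M \<noteq> {}"
    using zd T unfolding zero_dimensional_space_def by simp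
  have clo: "?clo (S f n)" for f n
  proof (induction n)
    case 0
    then show ?case
      using \<open>M \<noteq> {}\<close> T openin_topspace[of T] closedin_topspace[of T] by (simp add: S0)
  next
    case (Suc n)
    then show ?case
      unfolding SS by (intro P(1) r)
  qed
  have sub: "S f (Suc n) \<subseteq> S f n" for f n
    using P(3)[OF clo[of f n] r] unfolding SS by blast
  have cong: "S f n = S f' n" if "\<And>i. i < n \<Longrightarrow> f i = f' i" for f f' n
    using that by (induction n) (simp_all add: S0 SS)
  have dis: "S f n \<inter> S f' n = {}" if i: "i < n" "f i \<noteq> f' i" for f f' i n
  proof -
    obtain k where k: "f k \<noteq> f' k" "\<And>j. j < k \<Longrightarrow> f j = f' j" "k \<le> i"
      using exists_least_iff[of "\<lambda>k. f k \<noteq> f' k"] i(2) by (metis not_less)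
    have "S f k = S f' k"
      using k(2) by (rule cong)
    then have "S f (Suc k) \<inter> S f' (Suc k) = {}"
      using P(2)[OF clo[of f k] r[of k]] k(1) unfolding SS disjoint_family_on_def by auto
    moreover have "S g n \<subseteq> S g (Suc k)" for g
      using lift_Suc_antimono_le[of "S g" "Suc k" n] sub k(3) i(1) by simp
    ultimately show ?thesis
      by blast
  qed
  have small: "\<exists>a. S f (Suc n) \<subseteq> mcball a (r n)" for f n
    unfolding SS by (rule P(4)[OF clo r])
  have rlim: "\<exists>n. r n < e" if "e > 0" for e
    unfolding r_def using reals_Archimedean[OF that] .
  have nest: "\<exists>l. l \<in> M \<and> \<Inter>(range C) = {l}"
    if "\<forall>n. closedin mtopology (C n)" "\<forall>n. C n \<noteq> {}" "decseq C" "\<forall>e>0. \<exists>n a. C n \<subseteq> mcball a e" for C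
    using M(2) that unfolding mcomplete_nest_sing by simp
  have "\<exists>l. l \<in> M \<and> \<Inter>(range (S f)) = {l}" for f
  proof -
    have "decseq (S f)"
      by (intro decseq_SucI sub)
    moreover have "\<exists>n a. S f n \<subseteq> mcball a e" if e: "e > 0" for e
    proof -
      obtain n where "r n < e"
        using rlim[OF e] by blast
      then have "mcball a (r n) \<subseteq> mcball a e" for a
        by (intro mcball_subset_concentric) simp
      then show ?thesis
        using small[of f n] by blast
    qed
    moreover have "closedin mtopology (S f n)" "S f n \<noteq> {}" for n
      using clo[of f n] T by auto
    ultimately show ?thesis
      using nest[of "S f"] by simp
  qed
  then obtain h where h: "\<And>f. h f \<in> M" "\<And>f. \<Inter>(range (S f)) = {h f}"
    by metis
  have hS: "h f \<in> S f n" for f n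
    using h(2)[of f] by blast
  have inj: "f i = f' i" if "h f' \<in> S f n" "i < n" for f f' i n
    using dis[OF that(2), of f f'] hS[of f' n] that(1) by blast
  have surj: "\<exists>f. h f = x" if x: "x \<in> M" for x
  proof -
    \<comment> \<open>the address of \<open>x\<close> picks at each level the piece that contains \<open>x\<close>\<close>
    define k where "k U n = (SOME k. x \<in> P U (r n) k)" for U n
    have k: "x \<in> P U (r n) (k U n)" if "?clo U" "x \<in> U" for U n
    proof -
      have "\<exists>k. x \<in> P U (r n) k"
        using P(3)[OF that(1) r[of n]] that(2) by blast
      then show ?thesis
        unfolding k_def by (rule someI_ex)
    qed
    define R where "R = rec_nat M (\<lambda>n U. P U (r n) (k U n))"
    define f where "f n = k (R n) n" for n
    have RS: "R n = S f n" for n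
    proof (induction n)
      case 0
      show ?case
        by (simp add: R_def S0)
    next
      case (Suc n)
      have "R (Suc n) = P (R n) (r n) (f n)"
        unfolding R_def f_def by simp
      then show ?case
        unfolding SS Suc .
    qed
    have "x \<in> S f n" for n
    proof (induction n)
      case 0
      show ?case
        using x by (simp add: S0)
    next
      case (Suc n)
      show ?case
        using k[OF clo Suc, of n] unfolding SS f_def[of n] RS .
    qed
    then have "x \<in> \<Inter>(range (S f))"
      by simp
    then show ?thesis
      unfolding h(2) by auto
  qed
  have "inj h"
  proof (rule injI)
    fix f f' assume "h f = h f'"
    then have "f i = f' i" for i
      using inj[of f' f "Suc i" i] hS[of f "Suc i"] by simp
    then show "f = f'"
      by blast
  qed
  have "bij_betw h UNIV M"
    unfolding bij_betw_def using \<open>inj h\<close> h(1) surj by (force simp: image_iff)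
  have cyl: "openin baire_space {f'. \<forall>i<n. f' i = f i}" for f n
  proof -
    have "{f'. \<forall>i<n. f' i = f i} = (\<Pi>\<^sub>E i\<in>UNIV. if i < n then {f i} else UNIV)"
      by (auto simp: PiE_iff split: if_splits)
    moreover have "finite {i. (if i < n then {f i} else UNIV) \<noteq> (UNIV :: nat set)}"
      by (rule finite_subset[of _ "{..<n}"]) auto
    ultimately show ?thesis
      by (simp add: openin_PiE_gen)
  qed
  have cont: "continuous_map baire_space T h"
    unfolding continuous_map_def
  proof (intro conjI allI impI)
    show "h \<in> topspace baire_space \<rightarrow> topspace T"
      using h(1) T by simp
    fix V assume V: "openin T V"
    have "\<exists>C. openin baire_space C \<and> f \<in> C \<and> C \<subseteq> {f. h f \<in> V}" if hf: "h f \<in> V" for f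
    proof -
      obtain e where e: "e > 0" "mball (h f) e \<subseteq> V"
        using V hf T by (auto simp: openin_mtopology)
      obtain n where n: "r n < e / 2"
        using rlim[of "e / 2"] e(1) by auto
      obtain a where a: "S f (Suc n) \<subseteq> mcball a (r n)"
        using small by blast
      have "h f' \<in> V" if "\<forall>i<Suc n. f' i = f i" for f'
      proof -
        have "S f' (Suc n) = S f (Suc n)"
          using that by (intro cong) blast
        then have "h f \<in> mcball a (r n)" "h f' \<in> mcball a (r n)"
          using hS[of f "Suc n"] hS[of f' "Suc n"] a by blast+
        then have "d (h f) (h f') \<le> r n + r n"
          using triangle[of "h f" a "h f'"] by (auto simp: commute)
        then have "d (h f) (h f') < e"
          using n by linarith
        then show ?thesis
          using e(2) h(1) by auto
      qed
      then show ?thesis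
        using cyl[of "Suc n" f] by (intro exI[of _ "{f'. \<forall>i<Suc n. f' i = f i}"]) auto
    qed
    then show "openin baire_space {f \<in> topspace baire_space. h f \<in> V}"
      by (subst openin_subopen) auto
  qed
  define g where "g = inv h"
  have gh: "g (h f) = f" for f
    unfolding g_def using \<open>inj h\<close> by simp
  have hg: "h (g x) = x" if "x \<in> M" for x
    using surj[OF that] gh by metis
  have "continuous_map T (discrete_topology UNIV) (\<lambda>x. g x i)" for i
    unfolding continuous_map_def
  proof (intro conjI allI impI)
    fix V :: "nat set"
    have "\<exists>W. openin T W \<and> x \<in> W \<and> W \<subseteq> {x \<in> M. g x i \<in> V}" if x: "x \<in> M" "g x i \<in> V" for x
    proof (intro exI[of _ "S (g x) (Suc i)"] conjI)
      show "openin T (S (g x) (Suc i))"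
        using clo by blast
      show "x \<in> S (g x) (Suc i)"
        using hS[of "g x" "Suc i"] hg[OF x(1)] by simp
      show "S (g x) (Suc i) \<subseteq> {x \<in> M. g x i \<in> V}"
      proof
        fix y assume y: "y \<in> S (g x) (Suc i)"
        have "openin T (S (g x) (Suc i))"
          using clo by blast
        then have "y \<in> M"
          using y openin_subset[of T] T by auto
        then have "g x i = g y i"
          using inj[of "g y" "g x" "Suc i" i] y hg by simp
        then show "y \<in> {x \<in> M. g x i \<in> V}"
          using \<open>y \<in> M\<close> x(2) by simp
      qed
    qed
    then show "openin T {x \<in> topspace T. g x i \<in> V}"
      using T by (subst openin_subopen) auto
  qed auto
  then have "continuous_map T baire_space g"
    by (simp add: continuous_map_componentwise_UNIV)
  then have "homeomorphic_maps T baire_space g h"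
    unfolding homeomorphic_maps_def using cont gh hg T by simp
  then show ?thesis
    unfolding homeomorphic_space_def by blast
qed

lemma irrational_between:
  fixes a b :: real
  assumes "a < b"
  shows "\<exists>x\<in>UNIV - \<rat>. a < x \<and> x < b"
proof -
  have "uncountable ({a<..<b} - \<rat>)"
    using uncountable_open_interval[of a b] assms countable_rat
    by (intro uncountable_minus_countable) auto
  then have "{a<..<b} - \<rat> \<noteq> {}"
    by (metis countable_empty)
  then show ?thesis
    by auto
qed

text \<open>
  Between irrationals, intervals with rational ends are the same whether open or closed.
\<close>

lemma zero_dimensional_irrationals:
  "zero_dimensional_space (top_of_set (UNIV - \<rat> :: real set))"
  unfolding zero_dimensional_space_alt
proof (intro conjI allI impI)
  show "topspace (top_of_set (UNIV - \<rat> :: real set)) \<noteq> {}"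
    using irrational_between[of 0 1] by auto
  fix V x assume "openin (top_of_set (UNIV - \<rat> :: real set)) V \<and> x \<in> V"
  then obtain G where G: "open G" "V = (UNIV - \<rat> :: real set) \<inter> G" "x \<in> G" "x \<in> (UNIV - \<rat> :: real set)"
    unfolding openin_open by blast
  then obtain e where e: "e > 0" "ball x e \<subseteq> G"
    using open_contains_ball by blast
  obtain p where p: "p \<in> \<rat>" "x - e < p" "p < x"
    using Rats_dense_in_real[of "x - e" x] e(1) by auto
  obtain q where q: "q \<in> \<rat>" "x < q" "q < x + e"
    using Rats_dense_in_real[of x "x + e"] e(1) by auto
  have "{p<..<q} \<subseteq> G"
    using e(2) p(2) q(3) by (auto simp: ball_def dist_real_def subset_iff)
  moreover have "openin (top_of_set (UNIV - \<rat> :: real set)) ((UNIV - \<rat> :: real set) \<inter> {p<..<q})"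
    by (simp add: openin_open_Int)
  moreover have "(UNIV - \<rat> :: real set) \<inter> {p<..<q} = (UNIV - \<rat> :: real set) \<inter> {p..q}"
    using p(1) q(1) by (auto simp: less_le)
  then have "closedin (top_of_set (UNIV - \<rat> :: real set)) ((UNIV - \<rat> :: real set) \<inter> {p<..<q})"
    by (simp add: closedin_closed_Int)
  ultimately show "\<exists>W. openin (top_of_set (UNIV - \<rat> :: real set)) W \<and> closedin (top_of_set (UNIV - \<rat> :: real set)) W \<and> x \<in> W \<and> W \<subseteq> V"
    using G p(3) q(2) by (intro exI[of _ "(UNIV - \<rat> :: real set) \<inter> {p<..<q}"]) auto
qed

text \<open>
  A compact set of irrationals is closed in the reals, but every nonempty relatively open set of
  irrationals has a rational limit point.
\<close>

theorem irrationals_homeomorphic_baire_space: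
  "top_of_set (UNIV - \<rat> :: real set) homeomorphic_space baire_space"
proof (rule homeomorphic_baire_space)
  let ?S = "UNIV - \<rat> :: real set"
  have "fsigma_in euclidean (\<rat> :: real set)"
  proof -
    have "fsigma_in euclidean (\<Union>((\<lambda>q. {q}) ` (\<rat> :: real set)))"
      using countable_rat by (intro fsigma_in_Union) (auto intro!: closed_imp_fsigma_in)
    then show ?thesis
      by simp
  qed
  then have "gdelta_in euclidean ?S"
    using gdelta_in_diff[OF gdelta_in_topspace] by force
  then show "completely_metrizable_space (top_of_set ?S)"
    by (intro completely_metrizable_space_gdelta_in completely_metrizable_space_euclidean)
  obtain \<B> :: "real set set" where B: "countable \<B>" "\<And>C. C \<in> \<B> \<Longrightarrow> open C"
    "\<And>S. open S \<Longrightarrow> \<exists>U. U \<subseteq> \<B> \<and> S = \<Union>U"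
    using univ_second_countable by blast
  have "\<exists>V\<in>\<B>. x \<in> V \<and> V \<subseteq> S" if "open S" "x \<in> S" for S x
    using B(3)[OF that(1)] that(2) by blast
  then have "second_countable (euclidean :: real topology)"
    unfolding second_countable_def using B(1,2) by auto
  then show "second_countable (top_of_set ?S)"
    by (rule second_countable_subtopology)
  show "zero_dimensional_space (top_of_set ?S)"
    by (rule zero_dimensional_irrationals)
  show "\<not> compactin (top_of_set ?S) U" if U: "openin (top_of_set ?S) U" "U \<noteq> {}" for U
  proof
    assume "compactin (top_of_set ?S) U"
    then have "closed U"
      by (simp add: compactin_subtopology compact_imp_closed)
    obtain G where G: "open G" "U = ?S \<inter> G"
      using U(1) unfolding openin_open by blast
    then obtain x e where e: "e > 0" "ball x e \<subseteq> G"
      using open_contains_ball U(2) by blast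
    obtain q where q: "q \<in> \<rat>" "x < q" "q < x + e"
      using Rats_dense_in_real[of x "x + e"] e(1) by auto
    have "q \<in> closure U"
      unfolding closure_approachable
    proof (intro allI impI)
      fix d :: real assume "d > 0"
      then obtain y where y: "y \<in> ?S" "q < y" "y < min (q + d) (x + e)"
        using irrational_between[of q "min (q + d) (x + e)"] q(3) by auto
      then have "y \<in> ball x e" "dist y q < d"
        using q(2) by (auto simp: dist_real_def)
      then show "\<exists>y\<in>U. dist y q < d"
        using G(2) e(2) y(1) by blast
    qed
    then show False
      using \<open>closed U\<close> q(1) G(2) by simp
  qed
qed

section \<open>Compactness of the hyperspace of subcontinua\<close>

lemma (in Metric_space) compact_space_imp_second_countable:
  assumes "compact_space mtopology"
  shows "second_countable mtopology"
proof -
  have "mtotally_bounded M"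
    using assms compactin_imp_mtotally_bounded by (simp add: compact_space_def)
  then have "\<exists>K. finite K \<and> K \<subseteq> M \<and> M \<subseteq> (\<Union>x\<in>K. mball x (inverse (real (Suc n))))" for n
    unfolding mtotally_bounded_def by simp
  then obtain K where K: "\<And>n. finite (K n)" "\<And>n. K n \<subseteq> M"
    "\<And>n. M \<subseteq> (\<Union>x\<in>K n. mball x (inverse (real (Suc n))))"
    by metis
  define \<B> where "\<B> = (\<Union>n. (\<lambda>x. mball x (inverse (real (Suc n)))) ` K n)"
  have "\<exists>V\<in>\<B>. x \<in> V \<and> V \<subseteq> U" if U: "openin mtopology U" "x \<in> U" for U x
  proof -
    obtain e where e: "e > 0" "mball x e \<subseteq> U" "x \<in> M"
      using U openin_mtopology by blast
    obtain n where n: "inverse (real (Suc n)) < e / 2"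
      using reals_Archimedean[of "e / 2"] e(1) by auto
    obtain y where y: "y \<in> K n" "x \<in> mball y (inverse (real (Suc n)))"
      using K(3)[of n] e(3) by blast
    have "mball y (inverse (real (Suc n))) \<subseteq> mball x e"
    proof
      fix z assume z: "z \<in> mball y (inverse (real (Suc n)))"
      then have "d x z \<le> d x y + d y z"
        using y(2) by (intro triangle) auto
      moreover have "d x y = d y x"
        by (rule commute)
      ultimately have "d x z < e"
        using z y(2) n by simp
      then show "z \<in> mball x e"
        using z e(3) by simp
    qed
    then show ?thesis
      using y e(2) unfolding \<B>_def by blast
  qed
  moreover have "countable \<B>"
    unfolding \<B>_def using K(1) by (simp add: countable_finite)
  moreover have "\<And>V. V \<in> \<B> \<Longrightarrow> openin mtopology V"
    unfolding \<B>_def by auto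
  ultimately show ?thesis
    unfolding second_countable_def by blast
qed

definition vietoris_subbase :: "'a topology \<Rightarrow> 'a set set set" where
  "vietoris_subbase T =
     (\<lambda>U. {A. A \<subseteq> U}) ` {U. openin T U} \<union> (\<lambda>U. {A. A \<inter> U \<noteq> {}}) ` {U. openin T U}"

text \<open>
  The Vietoris topology on the nonempty closed sets is introduced through its subbase, which is the
  form in which the subbase theorem of Alexander applies.
\<close>

definition vietoris :: "'a topology \<Rightarrow> 'a set topology" where
  "vietoris T = topology (arbitrary union_of
     (finite intersection_of (\<lambda>S. S \<in> vietoris_subbase T) relative_to {A. closedin T A \<and> A \<noteq> {}}))"

lemma topspace_vietoris: "topspace (vietoris T) = {A. closedin T A \<and> A \<noteq> {}}"
  unfolding vietoris_def by simp

lemma openin_vietoris_subbase: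
  assumes "S \<in> vietoris_subbase T"
  shows "openin (vietoris T) ({A. closedin T A \<and> A \<noteq> {}} \<inter> S)"
  unfolding vietoris_def openin_subbase
  by (intro arbitrary_union_of_inc relative_to_inc finite_intersection_of_inc assms)

lemma openin_vietoris_upper:
  "openin T U \<Longrightarrow> openin (vietoris T) {A. closedin T A \<and> A \<noteq> {} \<and> A \<subseteq> U}"
  using openin_vietoris_subbase[of "{A. A \<subseteq> U}" T]
  by (simp add: vietoris_subbase_def Int_def conj_assoc)

lemma openin_vietoris_hit:
  "openin T U \<Longrightarrow> openin (vietoris T) {A. closedin T A \<and> A \<noteq> {} \<and> A \<inter> U \<noteq> {}}"
  using openin_vietoris_subbase[of "{A. A \<inter> U \<noteq> {}}" T]
  unfolding vietoris_subbase_def by (auto simp: Int_def conj_assoc)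

text \<open>
  Take a cover by subbasic sets and let \<open>K\<close> be what the sets to be hit leave uncovered. If \<open>K\<close> is
  nonempty, then as a point of the hyperspace it must be covered by a condition \<open>A \<subseteq> U\<close>, so that \<open>U\<close> and
  the sets to be hit cover the space; finitely many of them suffice, and a closed set not contained
  in \<open>U\<close> hits one of the others.
\<close>

theorem compact_space_vietoris:
  assumes "compact_space T"
  shows "compact_space (vietoris T)"
proof (rule Alexander_subbase_alt)
  let ?E = "{A. closedin T A \<and> A \<noteq> {}}"
  show "topology (arbitrary union_of (finite intersection_of (\<lambda>S. S \<in> vietoris_subbase T) relative_to ?E)) = vietoris T"
    unfolding vietoris_def ..
  have "{A. A \<subseteq> topspace T} \<in> vietoris_subbase T"
    unfolding vietoris_subbase_def by auto
  then show "?E \<subseteq> \<Union>(vietoris_subbase T)"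
    using closedin_subset by fastforce
next
  let ?E = "{A. closedin T A \<and> A \<noteq> {}}"
  fix \<C> assume \<C>: "\<C> \<subseteq> vietoris_subbase T" "?E \<subseteq> \<Union>\<C>"
  define \<V> where "\<V> = {U. openin T U \<and> {A. A \<inter> U \<noteq> {}} \<in> \<C>}"
  define K where "K = topspace T - \<Union>\<V>"
  have "openin T (\<Union>\<V>)"
    unfolding \<V>_def by blast
  then have K: "closedin T K"
    unfolding K_def by blast
  obtain U where U: "openin T U" "K \<subseteq> U" "K \<noteq> {} \<longrightarrow> {A. A \<subseteq> U} \<in> \<C>" "K = {} \<longrightarrow> U = {}"
  proof (cases "K = {}")
    case True
    then show thesis
      by (intro that[of "{}"]) auto
  next
    case False
    then have "K \<in> \<Union>\<C>"
      using \<C>(2) K by auto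
    then obtain S where S: "S \<in> \<C>" "K \<in> S"
      by blast
    have "S \<in> vietoris_subbase T"
      using S(1) \<C>(1) by blast
    then obtain U where "openin T U" "S = {A. A \<subseteq> U} \<or> S = {A. A \<inter> U \<noteq> {}}"
      unfolding vietoris_subbase_def by blast
    moreover have "U \<subseteq> \<Union>\<V>" if "openin T U" "S = {A. A \<inter> U \<noteq> {}}"
      using that S(1) unfolding \<V>_def by blast
    moreover have "K \<inter> \<Union>\<V> = {}"
      unfolding K_def by blast
    ultimately have U: "openin T U" "S = {A. A \<subseteq> U}"
      using S(2) by auto
    with S show thesis
      using False by (intro that[of U]) auto
  qed
  have "\<exists>\<F>. finite \<F> \<and> \<F> \<subseteq> insert U \<V> \<and> topspace T \<subseteq> \<Union>\<F>"
    using assms U(1,2) unfolding compact_space_alt K_def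
    by (elim allE[of _ "insert U \<V>"]) (auto simp: \<V>_def)
  then obtain \<F> where \<F>: "finite \<F>" "\<F> \<subseteq> insert U \<V>" "topspace T \<subseteq> \<Union>\<F>"
    by blast
  define \<G> where "\<G> = \<F> \<inter> \<V>"
  have cov: "A \<subseteq> U \<or> (\<exists>G\<in>\<G>. A \<inter> G \<noteq> {})" if A: "A \<subseteq> topspace T" for A
  proof (cases "A \<subseteq> U")
    case False
    then obtain x where x: "x \<in> A" "x \<notin> U" "x \<in> \<Union>\<F>"
      using A \<F>(3) by blast
    then show ?thesis
      using \<F>(2) unfolding \<G>_def by blast
  qed simp
  show "\<exists>\<C>'. finite \<C>' \<and> \<C>' \<subseteq> \<C> \<and> ?E \<subseteq> \<Union>\<C>'"
  proof (intro exI conjI)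
    let ?\<C>' = "(if K = {} then {} else {{A. A \<subseteq> U}}) \<union> (\<lambda>G. {A. A \<inter> G \<noteq> {}}) ` \<G>"
    show "finite ?\<C>'"
      using \<F>(1) unfolding \<G>_def by auto
    show "?\<C>' \<subseteq> \<C>"
      using U(3) unfolding \<G>_def \<V>_def by auto
    show "?E \<subseteq> \<Union>?\<C>'"
    proof
      fix A assume A: "A \<in> ?E"
      then have "A \<subseteq> topspace T" "A \<noteq> {}"
        using closedin_subset by auto
      then show "A \<in> \<Union>?\<C>'"
        using cov[of A] U(4) by (cases "K = {}") auto
    qed
  qed
qed

text \<open>
  A disconnected closed set has disjoint closed parts, which normality separates by open sets \<open>U\<close>
  and \<open>V\<close>; no connected set inside \<open>U \<union> V\<close> can meet both.
\<close>

lemma closedin_vietoris_subcontinua: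
  assumes T: "compact_space T" "Hausdorff_space T"
  shows "closedin (vietoris T) (subcontinua T)"
proof -
  have sub: "subcontinua T \<subseteq> topspace (vietoris T)"
    unfolding subcontinua_def topspace_vietoris by auto
  have norm: "normal_space T"
    using T compact_Hausdorff_or_regular_imp_normal_space by blast
  have "\<exists>W. openin (vietoris T) W \<and> A \<in> W \<and> W \<subseteq> topspace (vietoris T) - subcontinua T"
    if A: "A \<in> topspace (vietoris T) - subcontinua T" for A
  proof -
    have cA: "closedin T A" and neA: "A \<noteq> {}" and nc: "\<not> connectedin T A"
      using A unfolding topspace_vietoris subcontinua_def by auto
    obtain E1 E2 where E: "closedin T E1" "closedin T E2" "A \<subseteq> E1 \<union> E2" "E1 \<inter> E2 \<inter> A = {}"
      "E1 \<inter> A \<noteq> {}" "E2 \<inter> A \<noteq> {}"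
      using nc closedin_subset[OF cA] unfolding connectedin_closedin by metis
    have "closedin T (E1 \<inter> A)" "closedin T (E2 \<inter> A)" "disjnt (E1 \<inter> A) (E2 \<inter> A)"
      using E cA by (auto simp: disjnt_def)
    then obtain U V where UV: "openin T U" "openin T V" "E1 \<inter> A \<subseteq> U" "E2 \<inter> A \<subseteq> V" "disjnt U V"
      using norm unfolding normal_space_def by metis
    let ?W = "{B. closedin T B \<and> B \<noteq> {} \<and> B \<subseteq> U \<union> V} \<inter> {B. closedin T B \<and> B \<noteq> {} \<and> B \<inter> U \<noteq> {}}
        \<inter> {B. closedin T B \<and> B \<noteq> {} \<and> B \<inter> V \<noteq> {}}"
    have "openin (vietoris T) ?W"
      using UV by (intro openin_Int openin_vietoris_upper openin_vietoris_hit openin_Un)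
    moreover have "A \<in> ?W"
      using cA neA E UV by auto
    moreover have "\<not> connectedin T B" if "B \<in> ?W" for B
      using that UV connectedinD[of T B U V] by (auto simp: disjnt_def)
    ultimately show ?thesis
      unfolding topspace_vietoris subcontinua_def by (intro exI[of _ ?W]) auto
  qed
  then have "openin (vietoris T) (topspace (vietoris T) - subcontinua T)"
    by (subst openin_subopen) blast
  then show ?thesis
    using sub unfolding closedin_def by blast
qed

lemma openin_hyperspace_upper:
  assumes X: "continuum X" and U: "openin (mtopology_of X) U"
  shows "openin (mtopology_of (continuum_hyperspace X)) {A \<in> subcontinua (mtopology_of X). A \<subseteq> U}"
proof -
  interpret X: Metric_space "mspace X" "mdist X"
    by simp
  let ?C = "subcontinua (mtopology_of X)" and ?H = "continuum_hyperspace X"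
  interpret H: Metric_space ?C "mdist ?H"
    using Metric_space_mspace_mdist[of ?H] mspace_continuum_hyperspace[OF X] by simp
  have H: "mtopology_of ?H = H.mtopology"
    unfolding mtopology_of_def mspace_continuum_hyperspace[OF X] ..
  have "\<exists>e>0. H.mball A e \<subseteq> {A \<in> ?C. A \<subseteq> U}" if A: "A \<in> ?C" "A \<subseteq> U" for A
  proof -
    have "compactin X.mtopology A"
      using A(1) X unfolding subcontinua_def continuum_def mtopology_of_def
      by (auto intro: closedin_compact_space)
    then obtain e where e: "e > 0" "\<forall>x\<in>A. \<exists>V\<in>{U}. X.mball x e \<subseteq> V"
      using X.lebesgue_number[of A "{U}"] A(2) U unfolding mtopology_of_def by auto
    have "B \<subseteq> U" if B: "B \<in> ?C" "mdist ?H A B < e" for B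
    proof -
      obtain r where r: "r < e" "B \<subseteq> (\<Union>a\<in>A. mball_of X a r)"
        using hausdorff_distance_witness[OF X A(1) B(1)] B mdist_continuum_hyperspace[OF X A(1) B(1)]
        by metis
      have "mball_of X a r \<subseteq> X.mball a e" for a
        using r(1) by auto
      then show ?thesis
        using r(2) e(2) by blast
    qed
    then have "H.mball A e \<subseteq> {A \<in> ?C. A \<subseteq> U}"
      unfolding H.mball_def by blast
    then show ?thesis
      using e(1) by blast
  qed
  then show ?thesis
    unfolding H H.openin_mtopology by auto
qed

lemma openin_hyperspace_hit:
  assumes X: "continuum X" and U: "openin (mtopology_of X) U"
  shows "openin (mtopology_of (continuum_hyperspace X)) {A \<in> subcontinua (mtopology_of X). A \<inter> U \<noteq> {}}"
proof -
  interpret X: Metric_space "mspace X" "mdist X"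
    by simp
  let ?C = "subcontinua (mtopology_of X)" and ?H = "continuum_hyperspace X"
  interpret H: Metric_space ?C "mdist ?H"
    using Metric_space_mspace_mdist[of ?H] mspace_continuum_hyperspace[OF X] by simp
  have H: "mtopology_of ?H = H.mtopology"
    unfolding mtopology_of_def mspace_continuum_hyperspace[OF X] ..
  have "\<exists>e>0. H.mball A e \<subseteq> {A \<in> ?C. A \<inter> U \<noteq> {}}" if A: "A \<in> ?C" "A \<inter> U \<noteq> {}" for A
  proof -
    obtain x where x: "x \<in> A" "x \<in> U"
      using A(2) by blast
    obtain e where e: "e > 0" "X.mball x e \<subseteq> U"
      using U x(2) unfolding mtopology_of_def X.openin_mtopology by blast
    have "B \<inter> U \<noteq> {}" if B: "B \<in> ?C" "mdist ?H A B < e" for B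
    proof -
      obtain r where r: "r < e" "A \<subseteq> (\<Union>b\<in>B. mball_of X b r)"
        using hausdorff_distance_witness[OF X A(1) B(1)] B mdist_continuum_hyperspace[OF X A(1) B(1)]
        by metis
      then obtain b where b: "b \<in> B" "x \<in> mball_of X b r"
        using x(1) by blast
      then have "b \<in> X.mball x e"
        using r(1) by (auto simp: X.commute)
      then show ?thesis
        using e(2) b(1) by blast
    qed
    then have "H.mball A e \<subseteq> {A \<in> ?C. A \<inter> U \<noteq> {}}"
      unfolding H.mball_def by blast
    then show ?thesis
      using e(1) by blast
  qed
  then show ?thesis
    unfolding H H.openin_mtopology by auto
qed

text \<open>
  This is the harder half of the agreement between the Hausdorff metric and the Vietoris topology: to be
  close to \<open>A\<close> it is enough to stay in a neighbourhood of \<open>A\<close> and to hit the members of a finite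
  cover of \<open>A\<close> by small balls.
\<close>

lemma hyperspace_basic_neighbourhood:
  assumes X: "continuum X" and S: "openin (mtopology_of (continuum_hyperspace X)) \<S>" "A \<in> \<S>"
  obtains U \<V> where "openin (mtopology_of X) U" "finite \<V>" "\<And>V. V \<in> \<V> \<Longrightarrow> openin (mtopology_of X) V"
    "A \<subseteq> U" "\<And>V. V \<in> \<V> \<Longrightarrow> A \<inter> V \<noteq> {}"
    "{B \<in> subcontinua (mtopology_of X). B \<subseteq> U \<and> (\<forall>V\<in>\<V>. B \<inter> V \<noteq> {})} \<subseteq> \<S>"
proof -
  interpret X: Metric_space "mspace X" "mdist X"
    by simp
  let ?C = "subcontinua (mtopology_of X)" and ?H = "continuum_hyperspace X"
  interpret H: Metric_space ?C "mdist ?H"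
    using Metric_space_mspace_mdist[of ?H] mspace_continuum_hyperspace[OF X] by simp
  have H: "mtopology_of ?H = H.mtopology"
    unfolding mtopology_of_def mspace_continuum_hyperspace[OF X] ..
  obtain e where e: "e > 0" "H.mball A e \<subseteq> \<S>"
    using S unfolding H H.openin_mtopology by blast
  have A: "A \<in> ?C"
    using S unfolding H H.openin_mtopology by blast
  have AX: "A \<subseteq> mspace X"
    using subcontinua_subset[OF A] .
  have "X.mtotally_bounded A"
    using A X unfolding subcontinua_def continuum_def mtopology_of_def
    by (auto intro!: X.compactin_imp_mtotally_bounded closedin_compact_space)
  then obtain K where K: "finite K" "K \<subseteq> A" "A \<subseteq> (\<Union>x\<in>K. X.mball x (e / 4))"
    using e(1) unfolding X.mtotally_bounded_def by (metis zero_less_divide_iff zero_less_numeral)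
  define U where "U = (\<Union>a\<in>A. X.mball a (e / 2))"
  define \<V> where "\<V> = (\<lambda>x. X.mball x (e / 4)) ` K"
  show thesis
  proof
    show "openin (mtopology_of X) U"
      unfolding U_def mtopology_of_def by auto
    show "finite \<V>"
      unfolding \<V>_def using K(1) by blast
    show "openin (mtopology_of X) V" if "V \<in> \<V>" for V
      using that unfolding \<V>_def mtopology_of_def by auto
    show "A \<subseteq> U"
    proof
      fix a assume "a \<in> A"
      moreover from this have "a \<in> X.mball a (e / 2)"
        using e(1) AX by auto
      ultimately show "a \<in> U"
        unfolding U_def by blast
    qed
    show "A \<inter> V \<noteq> {}" if "V \<in> \<V>" for V
    proof -
      obtain x where x: "x \<in> K" "V = X.mball x (e / 4)"
        using \<open>V \<in> \<V>\<close> unfolding \<V>_def by blast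
      then have "x \<in> V"
        using e(1) AX K(2) by auto
      then show ?thesis
        using x K(2) by blast
    qed
    show "{B \<in> ?C. B \<subseteq> U \<and> (\<forall>V\<in>\<V>. B \<inter> V \<noteq> {})} \<subseteq> \<S>"
    proof
      fix B assume "B \<in> {B \<in> ?C. B \<subseteq> U \<and> (\<forall>V\<in>\<V>. B \<inter> V \<noteq> {})}"
      then have B: "B \<in> ?C" "B \<subseteq> U" "\<And>x. x \<in> K \<Longrightarrow> B \<inter> X.mball x (e / 4) \<noteq> {}"
        unfolding \<V>_def by auto
      have "A \<subseteq> (\<Union>b\<in>B. mball_of X b (e / 2))"
      proof
        fix a assume "a \<in> A"
        then obtain x where x: "x \<in> K" "a \<in> X.mball x (e / 4)"
          using K(3) by blast
        then obtain b where b: "b \<in> B" "b \<in> X.mball x (e / 4)"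
          using B(3) by blast
        have "mdist X b a \<le> mdist X b x + mdist X x a"
          using x b by (intro X.triangle) auto
        then have "a \<in> mball_of X b (e / 2)"
          using x(2) b(2) X.commute[of b x] by auto
        then show "a \<in> (\<Union>b\<in>B. mball_of X b (e / 2))"
          using b(1) by blast
      qed
      moreover have "B \<subseteq> (\<Union>a\<in>A. mball_of X a (e / 2))"
        using B(2) unfolding U_def by (auto simp: mball_of_def)
      ultimately have "hausdorff_distance X A B \<le> e / 2"
        using e(1) by (intro hausdorff_distance_le) auto
      then have "mdist ?H A B < e"
        using e(1) mdist_continuum_hyperspace[OF X A B(1)] by simp
      then show "B \<in> \<S>"
        using e(2) A B(1) by auto
    qed
  qed
qed

text \<open>
  The subcontinua form a closed, hence compact, part of the Vietoris space, and the identity from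
  there to the metric hyperspace is continuous.
\<close>

theorem compact_space_hyperspace:
  assumes X: "continuum X"
  shows "compact_space (mtopology_of (continuum_hyperspace X))"
proof -
  let ?T = "mtopology_of X" and ?H = "mtopology_of (continuum_hyperspace X)"
  let ?C = "subcontinua ?T"
  have T: "compact_space ?T" "Hausdorff_space ?T"
    using X Metric_space.Hausdorff_space_mtopology[OF Metric_space_mspace_mdist]
    unfolding continuum_def mtopology_of_def by auto
  have "compactin (vietoris ?T) ?C"
    using closedin_compact_space[OF compact_space_vietoris[OF T(1)] closedin_vietoris_subcontinua[OF T]] .
  moreover have C: "?C \<subseteq> topspace (vietoris ?T)"
    unfolding subcontinua_def topspace_vietoris by auto
  ultimately have comp: "compact_space (subtopology (vietoris ?T) ?C)"
    by (simp add: compact_space_subtopology)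
  have topH: "topspace ?H = ?C"
    using mspace_continuum_hyperspace[OF X] by simp
  have "continuous_map (subtopology (vietoris ?T) ?C) ?H id"
    unfolding continuous_map_def
  proof (intro conjI allI impI)
    show "id \<in> topspace (subtopology (vietoris ?T) ?C) \<rightarrow> topspace ?H"
      unfolding topH by auto
    fix \<S> assume S: "openin ?H \<S>"
    have "\<exists>W. openin (subtopology (vietoris ?T) ?C) W \<and> A \<in> W \<and> W \<subseteq> \<S>" if A: "A \<in> \<S>" for A
    proof -
      obtain U \<V> where UV: "openin ?T U" "finite \<V>" "\<And>V. V \<in> \<V> \<Longrightarrow> openin ?T V"
        "A \<subseteq> U" "\<And>V. V \<in> \<V> \<Longrightarrow> A \<inter> V \<noteq> {}" "{B \<in> ?C. B \<subseteq> U \<and> (\<forall>V\<in>\<V>. B \<inter> V \<noteq> {})} \<subseteq> \<S>"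
        by (rule hyperspace_basic_neighbourhood[OF X S A]) (rule that)
      define \<W> where "\<W> = (\<lambda>V. {B. closedin ?T B \<and> B \<noteq> {} \<and> B \<inter> V \<noteq> {}}) ` \<V>"
      define W where "W = \<Inter>(insert {B. closedin ?T B \<and> B \<noteq> {} \<and> B \<subseteq> U} \<W>)"
      have "openin (vietoris ?T) W"
        unfolding W_def \<W>_def using UV(1-3)
        by (intro openin_Inter) (auto intro: openin_vietoris_upper openin_vietoris_hit)
      then have "openin (subtopology (vietoris ?T) ?C) (?C \<inter> W)"
        by (rule openin_subtopology_Int2)
      moreover have "A \<in> ?C"
        using A openin_subset[OF S] topH by blast
      moreover have "?C \<inter> W = {B \<in> ?C. B \<subseteq> U \<and> (\<forall>V\<in>\<V>. B \<inter> V \<noteq> {})}"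
        unfolding W_def \<W>_def subcontinua_def by auto
      ultimately show ?thesis
        using UV(4-6) by (intro exI[of _ "?C \<inter> W"]) auto
    qed
    then have "openin (subtopology (vietoris ?T) ?C) \<S>"
      by (subst openin_subopen) blast
    moreover have "{A \<in> topspace (subtopology (vietoris ?T) ?C). id A \<in> \<S>} = \<S>"
      using openin_subset[OF S] C topH by auto
    ultimately show "openin (subtopology (vietoris ?T) ?C) {A \<in> topspace (subtopology (vietoris ?T) ?C). id A \<in> \<S>}"
      by simp
  qed
  then have "compactin ?H (id ` topspace (subtopology (vietoris ?T) ?C))"
    using comp unfolding compact_space_def by (intro image_compactin) auto
  moreover have "id ` topspace (subtopology (vietoris ?T) ?C) = topspace ?H"
    using C topH by auto
  ultimately show ?thesis
    unfolding compact_space_def by simp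
qed

section \<open>Arcs and branches in a dendrite\<close>

locale dendrite_space =
  fixes T :: "'a topology"
  assumes compact: "compact_space T" and connected: "connected_space T"
    and locally_connected: "locally_connected_space T" and Hausdorff: "Hausdorff_space T"
    and arcwise_connected: "arcwise_connected_space T"
    and hereditarily_unicoherent: "hereditarily_unicoherent_space T"
begin

text \<open>
  In a dendrite this intersection of all connected sets through \<open>x\<close> and \<open>y\<close> is the unique arc
  between them (\<open>embedding_image_eq_seg\<close>). Defined as an intersection it is symmetric, satisfies the
  triangle inclusion \<open>seg_triangle\<close> and is minimal among connected sets by its form alone.
\<close>

definition seg :: "'a \<Rightarrow> 'a \<Rightarrow> 'a set" where
  "seg x y = {t \<in> topspace T. \<forall>C. connectedin T C \<and> x \<in> C \<and> y \<in> C \<longrightarrow> t \<in> C}"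

text \<open>
  The component of the complement of \<open>p\<close> that contains \<open>q\<close>; it is empty when \<open>q = p\<close>.
\<close>

definition branch :: "'a \<Rightarrow> 'a \<Rightarrow> 'a set" where
  "branch p q = {z \<in> topspace T. p \<notin> seg q z}"

lemma seg_subset: "connectedin T C \<Longrightarrow> x \<in> C \<Longrightarrow> y \<in> C \<Longrightarrow> seg x y \<subseteq> C"
  unfolding seg_def by blast

lemma seg_subset_topspace: "seg x y \<subseteq> topspace T"
  unfolding seg_def by blast

lemma seg_commute: "seg x y = seg y x"
  unfolding seg_def by blast

lemma left_in_seg [simp]: "x \<in> topspace T \<Longrightarrow> x \<in> seg x y"
  and right_in_seg [simp]: "y \<in> topspace T \<Longrightarrow> y \<in> seg x y"
  unfolding seg_def by blast+

lemma seg_refl [simp]: "x \<in> topspace T \<Longrightarrow> seg x x = {x}"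
  using seg_subset[of "{x}" x x] by auto

lemma not_in_seg:
  assumes "t \<in> topspace T" "t \<notin> seg x y"
  obtains C where "connectedin T C" "x \<in> C" "y \<in> C" "t \<notin> C"
  using assms unfolding seg_def by blast

lemma seg_triangle: "seg x z \<subseteq> seg x y \<union> seg y z"
proof
  fix t assume t: "t \<in> seg x z"
  then have tX: "t \<in> topspace T"
    using seg_subset_topspace by blast
  show "t \<in> seg x y \<union> seg y z"
  proof (rule ccontr)
    assume "t \<notin> seg x y \<union> seg y z"
    then obtain C D where C: "connectedin T C" "x \<in> C" "y \<in> C" "t \<notin> C"
      and D: "connectedin T D" "y \<in> D" "z \<in> D" "t \<notin> D"
      using not_in_seg[OF tX] by (metis Un_iff)
    then have "connectedin T (C \<union> D)"
      by (intro connectedin_Un) auto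
    then show False
      using seg_subset[of "C \<union> D" x z] C D t by blast
  qed
qed

lemma openin_minus_finite:
  assumes "finite S"
  shows "openin T (topspace T - S)"
proof -
  have "finite (topspace T \<inter> S)" "topspace T \<inter> S \<subseteq> topspace T"
    using assms by auto
  then have "closedin T (topspace T \<inter> S)"
    using Hausdorff Hausdorff_imp_t1_space t1_space_closedin_finite by blast
  then have "openin T (topspace T - topspace T \<inter> S)"
    by blast
  moreover have "topspace T - topspace T \<inter> S = topspace T - S"
    by blast
  ultimately show ?thesis
    by simp
qed

lemma small_connected_neighbourhood:
  assumes "openin T G" "z \<in> G"
  obtains W where "openin T W" "connectedin T W" "z \<in> W" "T closure_of W \<subseteq> G"
proof -
  have "regular_space T"
    using compact Hausdorff compact_Hausdorff_imp_regular_space by blast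
  then obtain U V where UV: "openin T U" "closedin T V" "z \<in> U" "U \<subseteq> V" "V \<subseteq> G"
    using assms neighbourhood_base_of_closedin[of T] unfolding neighbourhood_base_of by metis
  obtain W where W: "openin T W" "connectedin T W" "z \<in> W" "W \<subseteq> U"
    using locally_connected UV(1,3) unfolding locally_connected_space by metis
  then have "T closure_of W \<subseteq> V"
    using UV by (intro closure_of_minimal) auto
  with W UV(5) show thesis
    using that by blast
qed

text \<open>
  Chains of small connected sets with closures inside \<open>G\<close> reach every point of \<open>G\<close>: the set of
  points reached and the set of points not reached are both open.
\<close>

lemma subcontinuum_in_open_connected:
  assumes G: "openin T G" "connectedin T G" and x: "x \<in> G" and y: "y \<in> G"
  obtains K where "closedin T K" "connectedin T K" "x \<in> K" "y \<in> K" "K \<subseteq> G"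
proof -
  let ?P = "\<lambda>z K. closedin T K \<and> connectedin T K \<and> x \<in> K \<and> z \<in> K \<and> K \<subseteq> G"
  define S where "S = {z \<in> G. \<exists>K. ?P z K}"
  have join: "?P w (K \<union> T closure_of W)"
    if "?P z K" "z \<in> T closure_of W" "w \<in> T closure_of W" "connectedin T W" "T closure_of W \<subseteq> G" for z w K W
    using that by (intro conjI connectedin_Un connectedin_closure_of closedin_Un) auto
  have nb: "\<exists>W. openin T W \<and> z \<in> W \<and> connectedin T W \<and> T closure_of W \<subseteq> G \<and> W \<subseteq> T closure_of W" if z: "z \<in> G" for z
  proof -
    obtain W where W: "openin T W" "connectedin T W" "z \<in> W" "T closure_of W \<subseteq> G"
      by (rule small_connected_neighbourhood[OF G(1) z])
    then have "W \<subseteq> T closure_of W"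
      by (simp add: closure_of_subset openin_subset)
    with W show ?thesis
      by blast
  qed
  have "\<exists>W. openin T W \<and> z \<in> W \<and> W \<subseteq> S" if z: "z \<in> S" for z
  proof -
    obtain K where K: "?P z K" "z \<in> G"
      using z unfolding S_def by blast
    obtain W where W: "openin T W" "z \<in> W" "connectedin T W" "T closure_of W \<subseteq> G" "W \<subseteq> T closure_of W"
      using nb[OF K(2)] by blast
    have "w \<in> S" if "w \<in> W" for w
      using join[OF K(1), of W w] W that unfolding S_def by blast
    then show ?thesis
      using W by blast
  qed
  then have "openin T S"
    by (subst openin_subopen) blast
  have "\<exists>W. openin T W \<and> z \<in> W \<and> W \<subseteq> G - S" if z: "z \<in> G - S" for z
  proof -
    obtain W where W: "openin T W" "z \<in> W" "connectedin T W" "T closure_of W \<subseteq> G" "W \<subseteq> T closure_of W"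
      using nb z by blast
    have "w \<notin> S" if w: "w \<in> W" for w
    proof
      assume "w \<in> S"
      then obtain K where "?P w K"
        unfolding S_def by blast
      then have "?P z (K \<union> T closure_of W)"
        using W z w by (intro join[where z = w]) auto
      then show False
        using z unfolding S_def by blast
    qed
    then show ?thesis
      using W by blast
  qed
  then have "openin T (G - S)"
    by (subst openin_subopen) blast
  moreover have "x \<in> S"
    using x G(2) connectedin_subset_topspace[OF G(2)] Hausdorff unfolding S_def
    by (auto intro!: exI[of _ "{x}"] simp: closedin_Hausdorff_singleton)
  ultimately have "G - S = {}"
    using connectedinD[OF G(2) \<open>openin T S\<close> \<open>openin T (G - S)\<close>] x by blast
  then show thesis
    using that y unfolding S_def by blast
qed

lemma connectedin_branch: "connectedin T (branch p q)"
proof (cases "p \<in> topspace T")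
  case True
  have "branch p q = \<Union>{C. connectedin T C \<and> q \<in> C \<and> p \<notin> C}"
  proof
    show "branch p q \<subseteq> \<Union>{C. connectedin T C \<and> q \<in> C \<and> p \<notin> C}"
      unfolding branch_def using not_in_seg[OF True] by blast
    show "\<Union>{C. connectedin T C \<and> q \<in> C \<and> p \<notin> C} \<subseteq> branch p q"
      unfolding branch_def using seg_subset connectedin_subset_topspace by fast
  qed
  then show ?thesis
    by (simp only:) (rule connectedin_Union, auto)
next
  case False
  then have "branch p q = topspace T"
    unfolding branch_def using seg_subset_topspace by blast
  then show ?thesis
    using connected by (simp add: connectedin_topspace)
qed

lemma branch_superset: "connectedin T C \<Longrightarrow> q \<in> C \<Longrightarrow> p \<notin> C \<Longrightarrow> C \<subseteq> branch p q"
  unfolding branch_def using seg_subset connectedin_subset_topspace by fast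

lemma point_notin_branch [simp]: "p \<notin> branch p q"
  unfolding branch_def by auto

lemma branch_subset_topspace: "branch p q \<subseteq> topspace T"
  unfolding branch_def by blast

lemma openin_branch: "openin T (branch p q)"
proof -
  have "\<exists>W. openin T W \<and> z \<in> W \<and> W \<subseteq> branch p q" if z: "z \<in> branch p q" for z
  proof -
    have "openin T (topspace T - {p})"
      by (rule openin_minus_finite) simp
    moreover have "z \<in> topspace T - {p}"
      using z branch_subset_topspace point_notin_branch by blast
    ultimately obtain W where W: "openin T W" "connectedin T W" "z \<in> W" "W \<subseteq> topspace T - {p}"
      using locally_connected unfolding locally_connected_space by metis
    have "w \<in> branch p q" if "w \<in> W" for w
    proof -
      have "p \<notin> seg z w"
        using seg_subset[OF W(2,3) that] W(4) by blast
      then show ?thesis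
        using seg_triangle[of q w z] z that W(4) unfolding branch_def by blast
    qed
    then show ?thesis
      using W by blast
  qed
  then show ?thesis
    by (subst openin_subopen) blast
qed

text \<open>
  Apply unicoherence to the subcontinuum \<open>K \<union> J\<close>.
\<close>

lemma connectedin_subcontinua_Int:
  assumes "closedin T K" "connectedin T K" "closedin T J" "connectedin T J" "K \<inter> J \<noteq> {}"
  shows "connectedin T (K \<inter> J)"
proof -
  let ?Y = "K \<union> J"
  have "connectedin T ?Y"
    using assms by (intro connectedin_Un) auto
  then have Y: "?Y \<in> subcontinua T"
    using assms unfolding subcontinua_def by auto
  have "K \<in> subcontinua (subtopology T ?Y)" "J \<in> subcontinua (subtopology T ?Y)"
    using assms unfolding subcontinua_def
    by (auto simp: connectedin_subtopology intro: closedin_subset_topspace)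
  moreover have "?Y = topspace (subtopology T ?Y)"
    using assms closedin_subset by fastforce
  ultimately have "connectedin (subtopology T ?Y) (K \<inter> J)"
    using hereditarily_unicoherent Y
    unfolding hereditarily_unicoherent_space_def unicoherent_space_def by metis
  then show ?thesis
    by (simp add: connectedin_subtopology)
qed

text \<open>
  A point \<open>p\<close> of an arc separates its ends in the whole dendrite. Otherwise the ends lie in a subcontinuum
  \<open>K\<close> missing \<open>p\<close>; by hereditary unicoherence \<open>K\<close> meets the arc in a connected set that
  contains both ends, hence in the whole arc.
\<close>

lemma embedding_image_eq_seg:
  assumes g: "embedding_map (top_of_set {0..1::real}) T g" and st: "0 \<le> s" "s \<le> t" "t \<le> 1"
  shows "g ` {s..t} = seg (g s) (g t)"
proof
  obtain h where gh: "homeomorphic_maps (top_of_set {0..1}) (subtopology T (g ` {0..1})) g h"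
    using g unfolding embedding_map_def homeomorphic_map_maps by auto
  have contg: "continuous_map (top_of_set {0..1}) T g"
    using g homeomorphic_imp_continuous_map continuous_map_into_fulltopology
    unfolding embedding_map_def by blast
  have sub: "{s..t} \<subseteq> {0..1}"
    using st by auto
  have J: "connectedin T (g ` {s..t})" "closedin T (g ` {s..t})"
  proof -
    have "connectedin (top_of_set {0..1}) {s..t}"
      using sub by (simp add: connectedin_subtopology)
    then show "connectedin T (g ` {s..t})"
      using contg connectedin_continuous_map_image by blast
    have "compactin (top_of_set {0..1}) {s..t}"
      using sub by (simp add: compactin_subtopology)
    then have "compactin T (g ` {s..t})"
      using contg image_compactin by blast
    then show "closedin T (g ` {s..t})"
      using Hausdorff compactin_imp_closedin by blast
  qed
  show "seg (g s) (g t) \<subseteq> g ` {s..t}"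
    using J(1) st by (intro seg_subset) auto
  show "g ` {s..t} \<subseteq> seg (g s) (g t)"
  proof
    fix p assume "p \<in> g ` {s..t}"
    then obtain r where r: "r \<in> {s..t}" "p = g r"
      by blast
    have p: "p \<in> topspace T"
      using J(2) closedin_subset \<open>p \<in> g ` {s..t}\<close> by blast
    show "p \<in> seg (g s) (g t)"
    proof (rule ccontr)
      assume "p \<notin> seg (g s) (g t)"
      then obtain C where C: "connectedin T C" "g s \<in> C" "g t \<in> C" "p \<notin> C"
        using not_in_seg[OF p] by blast
      then have "C \<subseteq> branch p (g s)"
        by (intro branch_superset)
      then have "g s \<in> branch p (g s)" "g t \<in> branch p (g s)"
        using C by auto
      then obtain K where K: "closedin T K" "connectedin T K" "g s \<in> K" "g t \<in> K" "K \<subseteq> branch p (g s)"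
        by (rule subcontinuum_in_open_connected[OF openin_branch connectedin_branch])
      have "g s \<in> K \<inter> g ` {s..t}" "g t \<in> K \<inter> g ` {s..t}"
        using K st by auto
      then have "connectedin T (K \<inter> g ` {s..t})"
        using K J by (intro connectedin_subcontinua_Int) auto
      then have "connectedin (subtopology T (g ` {0..1})) (K \<inter> g ` {s..t})"
        using sub by (auto simp: connectedin_subtopology)
      moreover have "continuous_map (subtopology T (g ` {0..1})) (top_of_set {0..1}) h"
        using gh unfolding homeomorphic_maps_def by blast
      ultimately have "connectedin (top_of_set {0..1}) (h ` (K \<inter> g ` {s..t}))"
        using connectedin_continuous_map_image by blast
      then have conn: "Topological_Spaces.connected (h ` (K \<inter> g ` {s..t}))"
        by (simp add: connectedin_subtopology)
      have hg: "h (g u) = u" if "u \<in> {0..1}" for u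
        using gh that unfolding homeomorphic_maps_def by auto
      have "s \<in> h ` (K \<inter> g ` {s..t})" "t \<in> h ` (K \<inter> g ` {s..t})"
        using \<open>g s \<in> K \<inter> _\<close> \<open>g t \<in> K \<inter> _\<close> hg[of s] hg[of t] st by force+
      then have "r \<in> h ` (K \<inter> g ` {s..t})"
        using r(1) conn by (meson atLeastAtMost_iff connected_contains_Icc subsetD)
      then obtain u where "u \<in> {s..t}" "g u \<in> K" "r = h (g u)"
        by blast
      then have "g r \<in> K"
        using hg sub by auto
      then show False
        using K(5) r(2) by auto
    qed
  qed
qed

lemma seg_parametrization:
  assumes "x \<in> topspace T" "y \<in> topspace T" "x \<noteq> y"
  obtains g :: "real \<Rightarrow> 'a" where "g 0 = x" "g 1 = y" "inj_on g {0..1}" "continuous_map (top_of_set {0..1}) T g"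
    "\<And>s t. 0 \<le> s \<Longrightarrow> s \<le> t \<Longrightarrow> t \<le> 1 \<Longrightarrow> seg (g s) (g t) = g ` {s..t}"
proof -
  obtain g where g: "embedding_map (top_of_set {0..1::real}) T g" "g 0 = x" "g 1 = y"
    using arcwise_connected assms unfolding arcwise_connected_space_def by blast
  have "inj_on g {0..1}"
    using g(1) homeomorphic_imp_injective_map unfolding embedding_map_def by fastforce
  moreover have "continuous_map (top_of_set {0..1}) T g"
    using g(1) homeomorphic_imp_continuous_map continuous_map_into_fulltopology
    unfolding embedding_map_def by blast
  ultimately show thesis
    using that g embedding_image_eq_seg[OF g(1)] by metis
qed

lemma seg_closed_connected:
  assumes "x \<in> topspace T" "y \<in> topspace T"
  shows "closedin T (seg x y)" "connectedin T (seg x y)"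
proof -
  have "closedin T (seg x y) \<and> connectedin T (seg x y)"
  proof (cases "x = y")
    case True
    then show ?thesis
      using assms Hausdorff by (simp add: closedin_Hausdorff_singleton)
  next
    case False
    obtain g where g: "g 0 = x" "g 1 = y" "continuous_map (top_of_set {0..1::real}) T g"
      "\<And>s t. 0 \<le> s \<Longrightarrow> s \<le> t \<Longrightarrow> t \<le> 1 \<Longrightarrow> seg (g s) (g t) = g ` {s..t}"
      by (rule seg_parametrization[OF assms False]) (rule that)
    have "seg x y = g ` {0..1}"
      using g(4)[of 0 1] g(1,2) by simp
    moreover have "compactin (top_of_set {0..1::real}) {0..1}" "connectedin (top_of_set {0..1::real}) {0..1}"
      by (simp_all add: compactin_subtopology connectedin_subtopology)
    ultimately show ?thesis
      using g(3) Hausdorff compactin_imp_closedin image_compactin connectedin_continuous_map_image by metis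
  qed
  then show "closedin T (seg x y)" "connectedin T (seg x y)"
    by auto
qed

lemma seg_mono:
  assumes "x \<in> topspace T" "y \<in> topspace T" "s \<in> seg x y" "t \<in> seg x y"
  shows "seg s t \<subseteq> seg x y"
  using assms by (intro seg_subset seg_closed_connected)

lemma seg_Int:
  assumes x: "x \<in> topspace T" and y: "y \<in> topspace T" and t: "t \<in> seg x y"
  shows "seg x t \<inter> seg t y = {t}"
proof (cases "x = y")
  case True
  then show ?thesis
    using x t by auto
next
  case False
  obtain g where g: "g 0 = x" "g 1 = y" "inj_on g {0..1::real}"
    "\<And>s t. 0 \<le> s \<Longrightarrow> s \<le> t \<Longrightarrow> t \<le> 1 \<Longrightarrow> seg (g s) (g t) = g ` {s..t}"
    by (rule seg_parametrization[OF x y False]) (rule that)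
  obtain r where r: "r \<in> {0..1}" "t = g r"
    using t g(4)[of 0 1] g(1,2) by auto
  have "seg x t \<inter> seg t y = g ` {0..r} \<inter> g ` {r..1}"
    using g(4)[of 0 r] g(4)[of r 1] g(1,2) r by simp
  also have "\<dots> = g ` ({0..r} \<inter> {r..1})"
    using r(1) by (intro inj_on_image_Int[OF g(3), symmetric]) auto
  also have "{0..r} \<inter> {r..1} = {r}"
    using r(1) by auto
  finally show ?thesis
    using r(2) by simp
qed

lemma seg_antisym:
  assumes "x \<in> topspace T" "y \<in> topspace T" "t \<in> seg x y" "t \<noteq> x"
  shows "x \<notin> seg t y"
  using seg_Int[OF assms(1-3)] left_in_seg[OF assms(1), of t] assms(4) by auto

text \<open>
  The points of an arc accumulate at its first end; whole initial arcs stay in \<open>U\<close>.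
\<close>

lemma seg_approach:
  assumes x: "x \<in> topspace T" and y: "y \<in> topspace T" and xy: "x \<noteq> y" and U: "openin T U" "x \<in> U"
  obtains t where "t \<in> seg x y" "t \<noteq> x" "t \<noteq> y" "seg x t \<subseteq> U"
proof -
  obtain g where g: "g 0 = x" "g 1 = y" "inj_on g {0..1::real}" "continuous_map (top_of_set {0..1}) T g"
    "\<And>s t. 0 \<le> s \<Longrightarrow> s \<le> t \<Longrightarrow> t \<le> 1 \<Longrightarrow> seg (g s) (g t) = g ` {s..t}"
    by (rule seg_parametrization[OF x y xy]) (rule that)
  have "openin (top_of_set {0..1}) {r \<in> {0..1}. g r \<in> U}"
    using g(4) U(1) by (auto simp: continuous_map_def)
  moreover have "0 \<in> {r \<in> {0..1}. g r \<in> U}"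
    using U(2) g(1) by simp
  ultimately obtain e where e: "e > 0" "ball 0 e \<inter> {0..1} \<subseteq> {r \<in> {0..1}. g r \<in> U}"
    unfolding openin_contains_ball by blast
  define r where "r = min (e / 2) (1 / 2)"
  have r: "0 < r" "r < 1" "r < e"
    using e(1) unfolding r_def by auto
  have "{0..r} \<subseteq> ball 0 e \<inter> {0..1}"
    using r by (auto simp: ball_def dist_real_def)
  then have "g ` {0..r} \<subseteq> U"
    using e(2) by blast
  moreover have "seg x (g r) = g ` {0..r}"
    using g(5)[of 0 r] r g(1) by simp
  moreover have "g r \<in> seg x y"
    using g(5)[of 0 1] r g(1,2) by simp
  moreover have "g r \<noteq> x" "g r \<noteq> y"
    using r g(1-3) inj_onD[OF g(3), of r 0] inj_onD[OF g(3), of r 1] by auto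
  ultimately show thesis
    using that by simp
qed

lemma in_branch_iff: "z \<in> branch p q \<longleftrightarrow> z \<in> topspace T \<and> p \<notin> seg q z"
  unfolding branch_def by blast

lemma branch_commute: "q \<in> topspace T \<Longrightarrow> z \<in> branch p q \<Longrightarrow> q \<in> branch p z"
  by (simp add: in_branch_iff seg_commute)

lemma branch_trans: "z \<in> branch p q \<Longrightarrow> w \<in> branch p z \<Longrightarrow> w \<in> branch p q"
  using seg_triangle[of q w z] by (auto simp: in_branch_iff)

lemma self_in_branch: "q \<in> topspace T \<Longrightarrow> q \<noteq> p \<Longrightarrow> q \<in> branch p q"
  by (auto simp: in_branch_iff)

lemma connectedin_insert_branch:
  assumes "p \<in> topspace T" "q \<in> topspace T" "q \<noteq> p"
  shows "connectedin T (insert p (branch p q))"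
proof (rule connectedin_intermediate_closure_of[OF connectedin_branch])
  have "p \<in> T closure_of (branch p q)"
    unfolding in_closure_of
  proof (intro conjI allI impI)
    fix U assume "p \<in> U \<and> openin T U"
    then obtain t where t: "t \<in> seg p q" "t \<noteq> p" "seg p t \<subseteq> U"
      using seg_approach[of p q U] assms by metis
    have "t \<in> topspace T"
      using t(1) seg_subset_topspace by blast
    moreover have "p \<notin> seg t q"
      using seg_antisym assms t by auto
    ultimately have "t \<in> branch p q" "t \<in> U"
      using t(3) by (auto simp: in_branch_iff seg_commute)
    then show "\<exists>y. y \<in> branch p q \<and> y \<in> U"
      by blast
  qed (use assms in auto)
  then show "insert p (branch p q) \<subseteq> T closure_of branch p q"
    using closure_of_subset[OF branch_subset_topspace] by blast
qed blast

lemma branch_disjoint: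
  assumes "r \<in> topspace T" "r \<notin> branch p q"
  shows "branch p r \<inter> branch p q = {}"
proof (rule ccontr)
  assume "branch p r \<inter> branch p q \<noteq> {}"
  then obtain z where "z \<in> branch p q" "r \<in> branch p z"
    using branch_commute assms(1) by blast
  then show False
    using branch_trans assms(2) by blast
qed

lemma connectedin_complement_branch:
  assumes p: "p \<in> topspace T"
  shows "connectedin T (topspace T - branch p q)"
proof -
  \<comment> \<open>the other branches together with \<open>p\<close>; the singleton covers the case that there are none\<close>
  define \<C> where "\<C> = insert {p} ((\<lambda>r. insert p (branch p r)) ` (topspace T - branch p q - {p}))"
  have "connectedin T (\<Union>\<C>)"
    using p by (intro connectedin_Union) (auto simp: \<C>_def intro: connectedin_insert_branch)
  moreover have "\<Union>\<C> = topspace T - branch p q"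
  proof
    show "\<Union>\<C> \<subseteq> topspace T - branch p q"
      using branch_disjoint[of _ p q] p branch_subset_topspace point_notin_branch[of p q] unfolding \<C>_def by fast
    show "topspace T - branch p q \<subseteq> \<Union>\<C>"
      unfolding \<C>_def using self_in_branch by auto
  qed
  ultimately show ?thesis
    by simp
qed

text \<open>
  Two distinct points in the boundary of \<open>A\<close> would be joined by an arc inside \<open>A\<close> and, since adding boundary
  points to the complement keeps it connected, also by an arc inside the complement and these two points;
  the two arcs coincide, which is impossible. The single boundary point is the required \<open>p\<close>.
\<close>

lemma connected_co_connected_eq:
  assumes A: "closedin T A" "connectedin T A" "A \<noteq> {}" "connectedin T (topspace T - A)"
    and q: "q \<in> topspace T" "q \<notin> A"
  obtains p where "p \<in> A" "A = topspace T - branch p q"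
proof -
  let ?G = "topspace T - A"
  have AX: "A \<subseteq> topspace T"
    using A(1) closedin_subset by blast
  have G: "openin T ?G"
    using A(1) by blast
  have fr: "C \<inter> A \<inter> T closure_of ?G \<noteq> {}" if C: "connectedin T C" "C \<inter> ?G \<noteq> {}" "C \<inter> A \<noteq> {}" for C
  proof -
    have "C \<inter> T frontier_of ?G \<noteq> {}"
      using C by (intro connectedin_Int_frontier_of) auto
    then show ?thesis
      using frontier_of_openin[OF G] connectedin_subset_topspace[OF C(1)] by blast
  qed
  have "topspace T \<inter> A \<inter> T closure_of ?G \<noteq> {}"
    using connected A(3) q AX by (intro fr) (auto simp: connectedin_topspace)
  then obtain p where p: "p \<in> A" "p \<in> T closure_of ?G"
    by blast
  have pX: "p \<in> topspace T"
    using p AX by blast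
  have uniq: "p' = p" if p': "p' \<in> A" "p' \<in> T closure_of ?G" for p'
  proof (rule ccontr)
    assume ne: "p' \<noteq> p"
    have "connectedin T (insert p (insert p' ?G))"
      using p p' closure_of_subset[of ?G T] by (intro connectedin_intermediate_closure_of[OF A(4)]) auto
    then have "seg p p' \<subseteq> insert p (insert p' ?G)"
      by (rule seg_subset) auto
    moreover have "seg p p' \<subseteq> A"
      using p p' A(2) by (intro seg_subset)
    ultimately have "seg p p' \<subseteq> {p, p'}"
      by blast
    moreover obtain t where "t \<in> seg p p'" "t \<noteq> p" "t \<noteq> p'"
      by (rule seg_approach[of p p' "topspace T"]) (use pX p'(1) AX ne in auto)
    ultimately show False
      by blast
  qed
  have "?G \<subseteq> branch p q"
    using q p(1) by (intro branch_superset A) auto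
  moreover have "branch p q \<inter> A = {}"
  proof (rule ccontr)
    assume "branch p q \<inter> A \<noteq> {}"
    moreover have "branch p q \<inter> ?G \<noteq> {}"
      using self_in_branch[of q p] q p by auto
    ultimately show False
      using fr[OF connectedin_branch] uniq by fastforce
  qed
  ultimately have "A = topspace T - branch p q"
    using AX branch_subset_topspace[of p q] by blast
  then show thesis
    using that p(1) by blast
qed

text \<open>
  The condition \<open>p \<notin> seg z q\<close> is stable under small changes of \<open>p\<close> and \<open>z\<close>: thicken the arc at \<open>z\<close>
  to a closed connected set that misses \<open>p\<close>. Compactness of \<open>F\<close> makes the change of \<open>p\<close> uniform.
\<close>

lemma seg_avoid_neighbourhood:
  assumes F: "closedin T F" and p: "p \<in> topspace T" and q: "q \<in> topspace T"
    and avoid: "\<And>z. z \<in> F \<Longrightarrow> p \<notin> seg z q"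
  obtains O' where "openin T O'" "p \<in> O'" "\<And>b z. b \<in> O' \<Longrightarrow> z \<in> F \<Longrightarrow> b \<notin> seg z q"
proof -
  let ?good = "\<lambda>W V. openin T W \<and> openin T V \<and> p \<in> V \<and> (\<forall>b\<in>V. \<forall>w\<in>W. b \<notin> seg w q)"
  define \<W> where "\<W> = {W. \<exists>V. ?good W V}"
  have cover: "\<exists>W\<in>\<W>. z \<in> W" if z: "z \<in> F" for z
  proof -
    have zX: "z \<in> topspace T"
      using z F closedin_subset by blast
    have "openin T (topspace T - {p})"
      by (rule openin_minus_finite) simp
    moreover have "z \<noteq> p"
      using avoid[OF z] zX by auto
    ultimately obtain W where W: "openin T W" "connectedin T W" "z \<in> W" "T closure_of W \<subseteq> topspace T - {p}"
      using small_connected_neighbourhood[of "topspace T - {p}" z] zX by blast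
    define K where "K = T closure_of W \<union> seg z q"
    have sub: "W \<subseteq> T closure_of W"
      using W(1) by (simp add: closure_of_subset openin_subset)
    have K: "closedin T K" "connectedin T K"
    proof -
      have "z \<in> T closure_of W \<inter> seg z q"
        using W(3) sub zX by auto
      then show "connectedin T K"
        unfolding K_def using W(2) zX q
        by (intro connectedin_Un connectedin_closure_of seg_closed_connected) auto
      show "closedin T K"
        unfolding K_def using zX q by (intro closedin_Un seg_closed_connected) auto
    qed
    have "b \<notin> seg w q" if "b \<in> topspace T - K" "w \<in> W" for b w
      using seg_subset[OF K(2), of w q] that sub q unfolding K_def by auto
    moreover have "p \<in> topspace T - K"
      using p W(4) avoid[OF z] unfolding K_def by blast
    ultimately have "?good W (topspace T - K)"
      using W(1) K(1) by blast
    then show ?thesis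
      using W(3) unfolding \<W>_def by blast
  qed
  have "compactin T F"
    using F compact closedin_compact_space by blast
  moreover have "F \<subseteq> \<Union>\<W>"
    using cover by blast
  moreover have "\<And>W. W \<in> \<W> \<Longrightarrow> openin T W"
    unfolding \<W>_def by blast
  ultimately obtain \<F> where \<F>: "finite \<F>" "\<F> \<subseteq> \<W>" "F \<subseteq> \<Union>\<F>"
    using compactinD[of T F \<W>] by blast
  have "\<forall>W\<in>\<F>. \<exists>V. ?good W V"
    using \<F>(2) unfolding \<W>_def by blast
  then obtain V where V: "\<And>W. W \<in> \<F> \<Longrightarrow> ?good W (V W)"
    by metis
  define O' where "O' = \<Inter>(insert (topspace T) (V ` \<F>))"
  show thesis
  proof
    show "openin T O'"
      unfolding O'_def using \<F>(1) V by (intro openin_Inter) auto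
    show "p \<in> O'"
      unfolding O'_def using V p by blast
    show "b \<notin> seg z q" if bz: "b \<in> O'" "z \<in> F" for b z
    proof -
      obtain W where W: "W \<in> \<F>" "z \<in> W"
        using bz(2) \<F>(3) by blast
      then have "b \<in> V W"
        using bz(1) unfolding O'_def by blast
      then show ?thesis
        using V[OF W(1)] W(2) by blast
    qed
  qed
qed

section \<open>Branching points\<close>

text \<open>
  The arc from \<open>x\<close> to \<open>y\<close> is connected and covered by the two arcs to \<open>w\<close>, so these meet on it.
\<close>

lemma median:
  assumes "x \<in> topspace T" "y \<in> topspace T" "w \<in> topspace T"
  obtains m where "m \<in> seg x y" "m \<in> seg w x" "m \<in> seg w y"
proof -
  have "\<not> (\<exists>E1 E2. closedin T E1 \<and> closedin T E2 \<and> seg x y \<subseteq> E1 \<union> E2 \<and> E1 \<inter> E2 \<inter> seg x y = {} \<and>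
      E1 \<inter> seg x y \<noteq> {} \<and> E2 \<inter> seg x y \<noteq> {})"
    using seg_closed_connected(2)[OF assms(1,2)] unfolding connectedin_closedin by blast
  moreover have "closedin T (seg w x)" "closedin T (seg w y)" "seg x y \<subseteq> seg w x \<union> seg w y"
    using assms seg_closed_connected seg_triangle[of x y w] by (auto simp: seg_commute)
  moreover have "x \<in> seg w x \<inter> seg x y" "y \<in> seg w y \<inter> seg x y"
    using assms by auto
  ultimately show thesis
    using that by blast
qed

text \<open>
  The point in which a path from \<open>f\<close> first meets the arc from \<open>x\<close> to \<open>y\<close> is determined by \<open>f\<close>.
\<close>

lemma median_unique:
  assumes X: "x \<in> topspace T" "y \<in> topspace T" "f \<in> topspace T"
    and b: "b \<in> seg x y" "b \<in> seg f x" "b \<in> seg f y"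
    and c: "c \<in> seg x y" "c \<in> seg f x" "c \<in> seg f y"
  shows "b = c"
proof -
  have bX: "b \<in> topspace T"
    using b(1) seg_subset_topspace by blast
  \<comment> \<open>whichever side of \<open>b\<close> the point \<open>c\<close> lies on, the path from \<open>f\<close> has already passed \<open>b\<close>\<close>
  have fx: "seg f b \<inter> seg b x = {b}" and fy: "seg f b \<inter> seg b y = {b}" and xy: "seg x b \<inter> seg b y = {b}"
    using seg_Int X b by auto
  show ?thesis
  proof (cases "c \<in> seg f b")
    case True
    moreover have "c \<in> seg b x \<or> c \<in> seg b y"
      using c(1) seg_triangle[of x y b] by (auto simp: seg_commute)
    ultimately have "c \<in> seg f b \<inter> seg b x \<or> c \<in> seg f b \<inter> seg b y"
      by blast
    then show ?thesis
      unfolding fx fy by auto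
  next
    case False
    then have "c \<in> seg b x" "c \<in> seg b y"
      using c(2,3) seg_triangle[of f x b] seg_triangle[of f y b] by auto
    then show ?thesis
      using xy by (auto simp: seg_commute)
  qed
qed

text \<open>
  Three points in different components of the complement of \<open>b\<close> witness that it has order at least three.
\<close>

definition branching :: "'a \<Rightarrow> bool" where
  "branching b \<longleftrightarrow> (\<exists>x\<in>topspace T - {b}. \<exists>y\<in>topspace T - {b}. \<exists>z\<in>topspace T - {b}.
     b \<in> seg x y \<and> b \<in> seg y z \<and> b \<in> seg z x)"

lemma branching_in_topspace: "branching b \<Longrightarrow> b \<in> topspace T"
  unfolding branching_def using seg_subset_topspace by blast

text \<open>
  Each of \<open>u\<close> and \<open>v\<close> lies in the component of at most one of the three witnesses.
\<close>

lemma third_branch: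
  assumes "branching b" and u: "u \<in> topspace T" and v: "v \<in> topspace T"
  obtains r where "r \<in> topspace T" "r \<noteq> b" "b \<in> seg r u" "b \<in> seg r v"
proof -
  obtain x y z where xyz: "x \<in> topspace T - {b}" "y \<in> topspace T - {b}" "z \<in> topspace T - {b}"
    "b \<in> seg x y" "b \<in> seg y z" "b \<in> seg z x"
    using assms(1) unfolding branching_def by blast
  have two: "b \<in> seg x w \<and> b \<in> seg y w \<or> b \<in> seg y w \<and> b \<in> seg z w \<or> b \<in> seg x w \<and> b \<in> seg z w" for w
    using xyz(4-6) seg_triangle[of x y w] seg_triangle[of y z w] seg_triangle[of z x w]
    by (auto simp: seg_commute)
  show thesis
    using two[of u] two[of v] xyz(1-3) that by blast
qed

definition arcwise_dense_branching :: bool where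
  "arcwise_dense_branching \<longleftrightarrow>
     (\<forall>x\<in>topspace T. \<forall>y\<in>topspace T. x \<noteq> y \<longrightarrow> (\<exists>b\<in>seg x y. b \<noteq> x \<and> b \<noteq> y \<and> branching b))"

lemma branching_in_seg:
  assumes "arcwise_dense_branching" "x \<in> topspace T" "y \<in> topspace T" "x \<noteq> y"
  obtains b where "branching b" "b \<in> seg x y" "b \<noteq> x" "b \<noteq> y"
  using assms unfolding arcwise_dense_branching_def by blast

lemma branching_near:
  assumes ad: "arcwise_dense_branching" and x: "x \<in> topspace T" and y: "y \<in> topspace T"
    and xy: "x \<noteq> y" and U: "openin T U" "x \<in> U"
  obtains b where "branching b" "b \<in> seg x y" "b \<noteq> x" "b \<noteq> y" "b \<in> U"
proof -
  obtain t where t: "t \<in> seg x y" "t \<noteq> x" "t \<noteq> y" "seg x t \<subseteq> U"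
    by (rule seg_approach[OF x y xy U])
  have tX: "t \<in> topspace T"
    using t(1) seg_subset_topspace by blast
  have "x \<noteq> t"
    using t(2) by simp
  then obtain b where b: "branching b" "b \<in> seg x t" "b \<noteq> x" "b \<noteq> t"
    by (rule branching_in_seg[OF ad x tX])
  have "b \<in> seg x y"
    using seg_mono[OF x y left_in_seg[OF x] t(1)] b(2) by auto
  moreover have "b \<noteq> y"
    using seg_antisym[of y x t] t x y b(2) by (auto simp: seg_commute)
  ultimately show thesis
    using that[of b] b t(4) by blast
qed

lemma openin_other_branches: "openin T (topspace T - insert p (branch p q))"
proof -
  have "topspace T - insert p (branch p q) = \<Union>(branch p ` (topspace T - branch p q))"
  proof
    show "topspace T - insert p (branch p q) \<subseteq> \<Union>(branch p ` (topspace T - branch p q))"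
      using self_in_branch by blast
    show "\<Union>(branch p ` (topspace T - branch p q)) \<subseteq> topspace T - insert p (branch p q)"
      using branch_disjoint[of _ p q] branch_subset_topspace[of p] point_notin_branch[of p] by fast
  qed
  then show ?thesis
    using openin_branch by auto
qed

lemma subset_branch:
  assumes "connectedin T B" "b \<notin> B" "B \<inter> branch b p \<noteq> {}"
  shows "B \<subseteq> branch b p"
proof -
  obtain z where z: "z \<in> B" "z \<in> branch b p"
    using assms(3) by blast
  then have "B \<subseteq> branch b z"
    using branch_superset assms by blast
  then show ?thesis
    using branch_trans[OF z(2)] by blast
qed

text \<open>
  To get rid of a further point \<open>f\<close> of the given branch at \<open>p\<close>, branch off between \<open>p\<close> and \<open>f\<close>,
  away from both of them.
\<close>

lemma branch_avoiding_finite: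
  assumes ad: "arcwise_dense_branching" and F: "finite F" "F \<subseteq> topspace T"
    and x: "x \<in> topspace T" and y: "y \<in> topspace T" and xy: "x \<noteq> y"
  obtains p q where "p \<in> topspace T" "q \<in> topspace T" "q \<noteq> p" "branch p q \<inter> F = {}"
proof -
  have "\<exists>p q. p \<in> topspace T \<and> q \<in> topspace T \<and> q \<noteq> p \<and> branch p q \<inter> F = {}"
    using F
  proof (induction F)
    case empty
    then show ?case
      using x y xy by blast
  next
    case (insert f F)
    then obtain p q where pq: "p \<in> topspace T" "q \<in> topspace T" "q \<noteq> p" "branch p q \<inter> F = {}"
      by auto
    have f: "f \<in> topspace T"
      using insert by simp
    show ?case
    proof (cases "f \<in> branch p q")
      case False
      then show ?thesis
        using pq by blast
    next
      case True
      then have "p \<noteq> f"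
        by auto
      then obtain b where b: "branching b" "b \<in> seg p f" "b \<noteq> p" "b \<noteq> f"
        by (rule branching_in_seg[OF ad pq(1) f])
      have bX: "b \<in> topspace T"
        using b(1) by (rule branching_in_topspace)
      obtain r where r: "r \<in> topspace T" "r \<noteq> b" "b \<in> seg r p" "b \<in> seg r f"
        by (rule third_branch[OF b(1) pq(1) f])
      have "p \<notin> seg b f"
        using seg_antisym pq(1) f b by blast
      then have "b \<in> branch p q"
        using branch_trans[OF True] bX by (auto simp: in_branch_iff seg_commute)
      moreover have "insert b (branch b r) \<subseteq> branch p b"
        using r(3) b(3) by (intro branch_superset connectedin_insert_branch bX r) (auto simp: in_branch_iff)
      ultimately have "branch b r \<subseteq> branch p q"
        using branch_trans[of b p q] by blast
      moreover have "f \<notin> branch b r"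
        using r(4) by (simp add: in_branch_iff)
      ultimately show ?thesis
        using pq(4) bX r(1,2) by blast
    qed
  qed
  then show thesis
    using that by blast
qed

end

section \<open>The space of subcontinua with connected complement\<close>

locale metric_dendrite =
  fixes X :: "'a metric"
  assumes dendrite: "dendrite X"

sublocale metric_dendrite \<subseteq> dendrite_space "mtopology_of X"
  using dendrite Metric_space.Hausdorff_space_mtopology[OF Metric_space_mspace_mdist]
  unfolding dendrite_def dendroid_def continuum_def mtopology_of_def
  by unfold_locales auto

context metric_dendrite
begin

declare topspace_mtopology_of [simp del]

abbreviation "T \<equiv> mtopology_of X"
abbreviation "N \<equiv> NC_star_space X"

lemma continuum: "continuum X"
  using dendrite unfolding dendrite_def dendroid_def by blast

lemma topspace_N: "topspace N = NC_star X"
  by (rule topspace_NC_star_space[OF continuum])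

lemma NC_star_iff:
  "A \<in> NC_star X \<longleftrightarrow> A \<noteq> {} \<and> closedin T A \<and> connectedin T A \<and> connectedin T (topspace T - A)"
  unfolding NC_star_def subcontinua_def by (auto simp: topspace_mtopology_of)

lemma NC_star_subset: "A \<in> NC_star X \<Longrightarrow> A \<subseteq> topspace T"
  unfolding NC_star_iff using closedin_subset by blast

lemma two_points:
  obtains x y where "x \<in> topspace T" "y \<in> topspace T" "x \<noteq> y"
  using continuum unfolding continuum_def topspace_mtopology_of by blast

lemma openin_N_upper:
  assumes "openin T U"
  shows "openin N {A \<in> NC_star X. A \<subseteq> U}"
proof -
  have "{A \<in> NC_star X. A \<subseteq> U} = NC_star X \<inter> {A \<in> subcontinua T. A \<subseteq> U}"
    unfolding NC_star_def by blast
  then show ?thesis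
    unfolding NC_star_space_def using openin_hyperspace_upper[OF continuum assms]
    by (simp add: openin_subtopology_Int2)
qed

lemma openin_N_hit:
  assumes "openin T U"
  shows "openin N {A \<in> NC_star X. A \<inter> U \<noteq> {}}"
proof -
  have "{A \<in> NC_star X. A \<inter> U \<noteq> {}} = NC_star X \<inter> {A \<in> subcontinua T. A \<inter> U \<noteq> {}}"
    unfolding NC_star_def by blast
  then show ?thesis
    unfolding NC_star_space_def using openin_hyperspace_hit[OF continuum assms]
    by (simp add: openin_subtopology_Int2)
qed

lemma N_basic_neighbourhood:
  assumes S: "openin N \<S>" "A \<in> \<S>"
  obtains U \<V> where "openin T U" "finite \<V>" "\<And>V. V \<in> \<V> \<Longrightarrow> openin T V"
    "A \<subseteq> U" "\<And>V. V \<in> \<V> \<Longrightarrow> A \<inter> V \<noteq> {}"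
    "{B \<in> NC_star X. B \<subseteq> U \<and> (\<forall>V\<in>\<V>. B \<inter> V \<noteq> {})} \<subseteq> \<S>"
proof -
  obtain \<S>' where S': "openin (mtopology_of (continuum_hyperspace X)) \<S>'" "\<S> = \<S>' \<inter> NC_star X"
    using S(1) unfolding NC_star_space_def openin_subtopology by blast
  have "A \<in> \<S>'"
    using S(2) S'(2) by blast
  then obtain U \<V> where "openin T U" "finite \<V>" "\<And>V. V \<in> \<V> \<Longrightarrow> openin T V"
    "A \<subseteq> U" "\<And>V. V \<in> \<V> \<Longrightarrow> A \<inter> V \<noteq> {}"
    and sub: "{B \<in> subcontinua T. B \<subseteq> U \<and> (\<forall>V\<in>\<V>. B \<inter> V \<noteq> {})} \<subseteq> \<S>'"
    by (rule hyperspace_basic_neighbourhood[OF continuum S'(1)]) (rule that)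
  moreover have "{B \<in> NC_star X. B \<subseteq> U \<and> (\<forall>V\<in>\<V>. B \<inter> V \<noteq> {})} \<subseteq> \<S>"
    using sub unfolding S'(2) NC_star_def by blast
  ultimately show thesis
    by (intro that[of U \<V>])
qed

lemma complement_branch_in_NC_star:
  assumes "p \<in> topspace T"
  shows "topspace T - branch p q \<in> NC_star X"
proof -
  have "topspace T - (topspace T - branch p q) = branch p q"
    using branch_subset_topspace by blast
  then show ?thesis
    using assms point_notin_branch[of p q] connectedin_complement_branch[OF assms] connectedin_branch openin_branch
    unfolding NC_star_iff by (auto simp del: topspace_mtopology_of)
qed

lemma openin_N_avoid: "openin N {A \<in> NC_star X. b \<notin> A}"
proof -
  have "openin T (topspace T - {b})"
    by (rule openin_minus_finite) simp
  moreover have "{A \<in> NC_star X. b \<notin> A} = {A \<in> NC_star X. A \<subseteq> topspace T - {b}}"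
    unfolding NC_star_iff using closedin_subset by fast
  ultimately show ?thesis
    using openin_N_upper by simp
qed

text \<open>
  A connected complement that misses \<open>b\<close> meets at most one of three components at \<open>b\<close>, so a member
  that contains \<open>b\<close> hits two of them; and a connected set that hits two of them contains \<open>b\<close>. Thus
  containing \<open>b\<close> amounts to hitting certain open sets.
\<close>

lemma clopen_N_contains:
  assumes "branching b"
  shows "openin N {A \<in> NC_star X. b \<in> A}" "closedin N {A \<in> NC_star X. b \<in> A}"
proof -
  obtain x y z where xyz: "x \<in> topspace T - {b}" "y \<in> topspace T - {b}" "z \<in> topspace T - {b}"
    "b \<in> seg x y" "b \<in> seg y z" "b \<in> seg z x"
    using assms unfolding branching_def by blast
  let ?H = "\<lambda>u v. {A \<in> NC_star X. A \<inter> branch b u \<noteq> {}} \<inter> {A \<in> NC_star X. A \<inter> branch b v \<noteq> {}}"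
  have "openin N (?H u v)" for u v
    by (intro openin_Int openin_N_hit openin_branch)
  moreover have "{A \<in> NC_star X. b \<in> A} = ?H x y \<union> ?H y z \<union> ?H z x"
  proof
    have "A \<in> ?H x y \<union> ?H y z \<union> ?H z x" if A: "A \<in> NC_star X" "b \<in> A" for A
    proof -
      have "connectedin T (topspace T - A)"
        using A(1) NC_star_iff by blast
      then have sep: "u \<in> A \<or> v \<in> A" if "b \<in> seg u v" "u \<in> topspace T" "v \<in> topspace T" for u v
        using seg_subset[of "topspace T - A" u v] A(2) that by blast
      have "x \<in> A \<and> y \<in> A \<or> y \<in> A \<and> z \<in> A \<or> z \<in> A \<and> x \<in> A"
        using sep[OF xyz(4)] sep[OF xyz(5)] sep[OF xyz(6)] xyz(1-3) by blast
      moreover have "x \<in> branch b x" "y \<in> branch b y" "z \<in> branch b z"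
        using xyz(1-3) self_in_branch by blast+
      ultimately show ?thesis
        using A(1) by blast
    qed
    then show "{A \<in> NC_star X. b \<in> A} \<subseteq> ?H x y \<union> ?H y z \<union> ?H z x"
      by blast
    have "b \<in> A" if A: "A \<in> ?H u v" "b \<in> seg u v" "v \<in> topspace T" for A u v
    proof (rule ccontr)
      assume "b \<notin> A"
      then have "A \<subseteq> branch b u" "A \<subseteq> branch b v" "A \<noteq> {}"
        using A(1) subset_branch[of A b] by (auto simp: NC_star_iff)
      then have "branch b v \<inter> branch b u \<noteq> {}"
        by blast
      moreover have "v \<notin> branch b u"
        using A(2) by (simp add: in_branch_iff)
      ultimately show False
        using branch_disjoint[OF A(3)] by blast
    qed
    then show "?H x y \<union> ?H y z \<union> ?H z x \<subseteq> {A \<in> NC_star X. b \<in> A}"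
      using xyz by fastforce
  qed
  ultimately show "openin N {A \<in> NC_star X. b \<in> A}"
    by auto
  have "topspace N - {A \<in> NC_star X. b \<in> A} = {A \<in> NC_star X. b \<notin> A}"
    unfolding topspace_N by blast
  then show "closedin N {A \<in> NC_star X. b \<in> A}"
    unfolding closedin_def using openin_N_avoid[of b] topspace_N by auto
qed

text \<open>
  A connected set missing \<open>b\<close> stays in one branch at \<open>b\<close>, so the complement of this condition asks for \<open>b\<close> or
  for the other branches, and both alternatives are open.
\<close>

lemma clopen_N_within:
  assumes b: "branching b"
  shows "openin N {A \<in> NC_star X. b \<notin> A \<and> A \<inter> branch b p \<noteq> {}}"
    "closedin N {A \<in> NC_star X. b \<notin> A \<and> A \<inter> branch b p \<noteq> {}}"
proof -
  let ?M = "{A \<in> NC_star X. b \<notin> A \<and> A \<inter> branch b p \<noteq> {}}"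
  have "?M = {A \<in> NC_star X. b \<notin> A} \<inter> {A \<in> NC_star X. A \<inter> branch b p \<noteq> {}}"
    by blast
  then show "openin N ?M"
    using openin_N_avoid openin_N_hit openin_branch by (simp add: openin_Int)
  have "topspace N - ?M = {A \<in> NC_star X. b \<in> A} \<union> {A \<in> NC_star X. A \<subseteq> topspace T - insert b (branch b p)}"
    (is "_ = ?K \<union> ?L")
  proof
    show "topspace N - ?M \<subseteq> ?K \<union> ?L"
    proof
      fix A assume A: "A \<in> topspace N - ?M"
      then have "A \<in> NC_star X"
        unfolding topspace_N by blast
      then have "A \<in> NC_star X" "A \<subseteq> topspace T"
        using NC_star_subset by auto
      then show "A \<in> ?K \<union> ?L"
        using A by blast
    qed
    show "?K \<union> ?L \<subseteq> topspace N - ?M"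
      unfolding topspace_N by blast
  qed
  then have "openin N (topspace N - ?M)"
    using clopen_N_contains(1)[OF b] openin_N_upper[OF openin_other_branches] by (simp add: openin_Un)
  then show "closedin N ?M"
    unfolding closedin_def topspace_N by blast
qed

section \<open>Dense branching makes the space zero-dimensional and nowhere compact\<close>

lemma branching_in_hit:
  assumes ad: "arcwise_dense_branching" and A: "A \<in> NC_star X" "x \<in> A" "y \<in> A" "x \<noteq> y"
    and U: "openin T U" "A \<inter> U \<noteq> {}"
  obtains b where "branching b" "b \<in> A \<inter> U"
proof -
  have AX: "A \<subseteq> topspace T" "connectedin T A"
    using A(1) closedin_subset unfolding NC_star_iff by auto
  obtain z where z: "z \<in> A" "z \<in> U"
    using U(2) by blast
  obtain a where a: "a \<in> A" "z \<noteq> a"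
    using A(2-4) by metis
  obtain b where "branching b" "b \<in> seg z a" "b \<in> U"
    by (rule branching_near[OF ad _ _ a(2) U(1) z(2)]) (use AX z a in auto)
  then show thesis
    using that seg_subset[OF AX(2) z(1) a(1)] by blast
qed

text \<open>
  Moving the cut point \<open>p\<close> of \<open>A\<close> slightly into the complement, to a branching point \<open>b\<close> on the arc to
  \<open>q\<close>, keeps the closed set outside \<open>U\<close> behind \<open>b\<close>. All members on the side of \<open>p\<close> then lie in \<open>U\<close>.
\<close>

lemma upper_within:
  assumes ad: "arcwise_dense_branching" and A: "A \<in> NC_star X" "A \<noteq> topspace T"
    and U: "openin T U" "A \<subseteq> U"
  obtains p q b where "p \<in> A" "q \<in> topspace T" "q \<notin> A" "A = topspace T - branch p q"
    "branching b" "b \<in> seg p q" "b \<noteq> p" "b \<noteq> q" "b \<notin> A"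
    "\<And>B. B \<in> NC_star X \<Longrightarrow> b \<notin> B \<Longrightarrow> B \<inter> branch b p \<noteq> {} \<Longrightarrow> B \<subseteq> U"
proof -
  have A': "closedin T A" "connectedin T A" "A \<noteq> {}" "connectedin T (topspace T - A)"
    using A(1) unfolding NC_star_iff by auto
  have AX: "A \<subseteq> topspace T"
    using A'(1) closedin_subset by blast
  then obtain q where q: "q \<in> topspace T" "q \<notin> A"
    using A(2) by blast
  obtain p where p: "p \<in> A" "A = topspace T - branch p q"
    by (rule connected_co_connected_eq[OF A' q])
  have pX: "p \<in> topspace T" and pq: "p \<noteq> q"
    using p(1) AX q by auto
  have "p \<notin> seg z q" if z: "z \<in> topspace T - U" for z
  proof -
    have "z \<in> branch p q"
      using z U(2) p(2) by blast
    then show ?thesis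
      by (simp add: in_branch_iff seg_commute)
  qed
  moreover have "closedin T (topspace T - U)"
    using U(1) by auto
  ultimately obtain O' where O': "openin T O'" "p \<in> O'"
    "\<And>b z. b \<in> O' \<Longrightarrow> z \<in> topspace T - U \<Longrightarrow> b \<notin> seg z q"
    using seg_avoid_neighbourhood[of "topspace T - U" p q] pX q(1) by metis
  obtain b where b: "branching b" "b \<in> seg p q" "b \<noteq> p" "b \<noteq> q" "b \<in> O'"
    by (rule branching_near[OF ad pX q(1) pq O'(1,2)])
  have bX: "b \<in> topspace T"
    using b(1) by (rule branching_in_topspace)
  have bA: "b \<notin> A"
    using seg_antisym[OF pX q(1) b(2,3)] bX p(2) by (simp add: in_branch_iff seg_commute)
  have "B \<subseteq> U" if B: "B \<in> NC_star X" "b \<notin> B" "B \<inter> branch b p \<noteq> {}" for B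
  proof -
    have "B \<subseteq> branch b p"
      using B by (intro subset_branch) (auto simp: NC_star_iff)
    moreover have "p \<notin> branch b q"
      using b(2) by (simp add: in_branch_iff seg_commute)
    then have "branch b p \<inter> branch b q = {}"
      by (rule branch_disjoint[OF pX])
    moreover have "topspace T - U \<subseteq> branch b q"
      using O'(3)[OF b(5)] by (auto simp: in_branch_iff seg_commute)
    ultimately show ?thesis
      using branch_subset_topspace[of b p] by blast
  qed
  then show thesis
    using that p q b bA by blast
qed

text \<open>
  For a neighbourhood of the whole space it suffices to contain finitely many branching points; for any other
  member \<open>A\<close> one adds the condition to stay on the side of \<open>p\<close> of a branching point \<open>b\<close> just outside \<open>A\<close>.
\<close>

lemma N_clopen_basis:
  assumes ad: "arcwise_dense_branching" and S: "openin N \<S>" "A \<in> \<S>"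
  obtains (whole) F where "finite F" "F \<subseteq> A" "\<And>x. x \<in> F \<Longrightarrow> branching x"
      "A = topspace T" "{B \<in> NC_star X. F \<subseteq> B} \<subseteq> \<S>"
  | (proper) F p q b where "finite F" "F \<subseteq> A" "\<And>x. x \<in> F \<Longrightarrow> branching x"
      "p \<in> A" "q \<in> topspace T" "q \<notin> A" "A = topspace T - branch p q"
      "branching b" "b \<in> seg p q" "b \<noteq> p" "b \<noteq> q" "b \<notin> A"
      "{B \<in> NC_star X. b \<notin> B \<and> B \<inter> branch b p \<noteq> {} \<and> F \<subseteq> B} \<subseteq> \<S>"
proof -
  have A: "A \<in> NC_star X"
    using S openin_subset topspace_N by blast
  have AX: "A \<subseteq> topspace T" "A \<noteq> {}"
    using A closedin_subset unfolding NC_star_iff by auto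
  obtain U \<V> where UV: "openin T U" "finite \<V>" "\<And>V. V \<in> \<V> \<Longrightarrow> openin T V"
    "A \<subseteq> U" "\<And>V. V \<in> \<V> \<Longrightarrow> A \<inter> V \<noteq> {}"
    "{B \<in> NC_star X. B \<subseteq> U \<and> (\<forall>V\<in>\<V>. B \<inter> V \<noteq> {})} \<subseteq> \<S>"
    by (rule N_basic_neighbourhood[OF S]) (rule that)
  \<comment> \<open>finitely many branching points take care of the sets to be hit; a one-point \<open>A\<close> needs none\<close>
  obtain U' F where UF: "openin T U'" "A \<subseteq> U'" "finite F" "F \<subseteq> A" "\<And>x. x \<in> F \<Longrightarrow> branching x"
    "{B \<in> NC_star X. B \<subseteq> U' \<and> F \<subseteq> B} \<subseteq> \<S>"
  proof (cases "\<exists>x y. x \<in> A \<and> y \<in> A \<and> x \<noteq> y")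
    case True
    then obtain x y where xy: "x \<in> A" "y \<in> A" "x \<noteq> y"
      by blast
    have "\<exists>b. branching b \<and> b \<in> A \<inter> V" if V: "V \<in> \<V>" for V
      by (rule branching_in_hit[OF ad A xy UV(3)[OF V] UV(5)[OF V]]) blast
    then obtain f where f: "\<And>V. V \<in> \<V> \<Longrightarrow> branching (f V) \<and> f V \<in> A \<inter> V"
      by metis
    show thesis
    proof (rule that[of U "f ` \<V>"])
      show "{B \<in> NC_star X. B \<subseteq> U \<and> f ` \<V> \<subseteq> B} \<subseteq> \<S>"
        using f UV(6) by fast
    qed (use f UV in auto)
  next
    case False
    then obtain e where e: "A = {e}"
      using AX(2) by blast
    define U' where "U' = \<Inter>(insert U \<V>)"
    show thesis
    proof (rule that[of U' "{}"])
      show "openin T U'"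
        unfolding U'_def using UV(1-3) by (intro openin_Inter) auto
      show "A \<subseteq> U'"
        unfolding U'_def using e UV(4,5) by auto
      show "{B \<in> NC_star X. B \<subseteq> U' \<and> {} \<subseteq> B} \<subseteq> \<S>"
      proof
        fix B assume "B \<in> {B \<in> NC_star X. B \<subseteq> U' \<and> {} \<subseteq> B}"
        then have B: "B \<in> NC_star X" "B \<subseteq> U'"
          by auto
        have "B \<noteq> {}"
          using B(1) NC_star_iff by blast
        then have "\<forall>V\<in>\<V>. B \<inter> V \<noteq> {}"
          using B(2) unfolding U'_def by blast
        then show "B \<in> \<S>"
          using UV(6) B unfolding U'_def by blast
      qed
    qed auto
  qed
  show thesis
  proof (cases "A = topspace T")
    case True
    have "B \<subseteq> U'" if "B \<in> NC_star X" for B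
      using NC_star_subset[OF that] UF(2) True by blast
    then have "{B \<in> NC_star X. F \<subseteq> B} \<subseteq> \<S>"
      using UF(6) by blast
    then show thesis
      using whole UF(3-5) True by blast
  next
    case False
    obtain p q b where pqb: "p \<in> A" "q \<in> topspace T" "q \<notin> A" "A = topspace T - branch p q"
      "branching b" "b \<in> seg p q" "b \<noteq> p" "b \<noteq> q" "b \<notin> A"
      "\<And>B. B \<in> NC_star X \<Longrightarrow> b \<notin> B \<Longrightarrow> B \<inter> branch b p \<noteq> {} \<Longrightarrow> B \<subseteq> U'"
      by (rule upper_within[OF ad A False UF(1,2)]) (rule that)
    have "{B \<in> NC_star X. b \<notin> B \<and> B \<inter> branch b p \<noteq> {} \<and> F \<subseteq> B} \<subseteq> \<S>"
    proof
      fix B assume "B \<in> {B \<in> NC_star X. b \<notin> B \<and> B \<inter> branch b p \<noteq> {} \<and> F \<subseteq> B}"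
      then have "B \<in> NC_star X" "B \<subseteq> U'" "F \<subseteq> B"
        using pqb(10)[of B] by auto
      then show "B \<in> \<S>"
        using UF(6) by blast
    qed
    with UF(5) show thesis
      by (rule proper[OF UF(3,4) _ pqb(1-9)])
  qed
qed

lemma clopen_N_superset:
  assumes "finite F" "\<And>x. x \<in> F \<Longrightarrow> branching x"
  shows "openin N {B \<in> NC_star X. F \<subseteq> B}" "closedin N {B \<in> NC_star X. F \<subseteq> B}"
proof -
  have eq: "{B \<in> NC_star X. F \<subseteq> B} = \<Inter>(insert (topspace N) ((\<lambda>x. {B \<in> NC_star X. x \<in> B}) ` F))"
    unfolding topspace_N by auto
  show "openin N {B \<in> NC_star X. F \<subseteq> B}"
    unfolding eq using assms clopen_N_contains by (intro openin_Inter) auto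
  show "closedin N {B \<in> NC_star X. F \<subseteq> B}"
    unfolding eq using assms clopen_N_contains by (intro closedin_Inter) auto
qed

lemma topspace_in_NC_star: "topspace T \<in> NC_star X"
proof -
  have "topspace T \<noteq> {}"
    using two_points by blast
  then show ?thesis
    using connected unfolding NC_star_iff by (simp add: connectedin_topspace)
qed

lemma clopen_N_proper:
  assumes "finite F" "\<And>x. x \<in> F \<Longrightarrow> branching x" "branching b"
  shows "openin N {B \<in> NC_star X. b \<notin> B \<and> B \<inter> branch b p \<noteq> {} \<and> F \<subseteq> B}"
    "closedin N {B \<in> NC_star X. b \<notin> B \<and> B \<inter> branch b p \<noteq> {} \<and> F \<subseteq> B}"
proof -
  have eq: "{B \<in> NC_star X. b \<notin> B \<and> B \<inter> branch b p \<noteq> {} \<and> F \<subseteq> B} =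
      {B \<in> NC_star X. b \<notin> B \<and> B \<inter> branch b p \<noteq> {}} \<inter> {B \<in> NC_star X. F \<subseteq> B}"
    by blast
  show "openin N {B \<in> NC_star X. b \<notin> B \<and> B \<inter> branch b p \<noteq> {} \<and> F \<subseteq> B}"
    "closedin N {B \<in> NC_star X. b \<notin> B \<and> B \<inter> branch b p \<noteq> {} \<and> F \<subseteq> B}"
    unfolding eq using clopen_N_within[OF assms(3)] clopen_N_superset[OF assms(1,2)]
    by (simp_all add: openin_Int closedin_Int)
qed

theorem zero_dimensional_N:
  assumes ad: "arcwise_dense_branching"
  shows "zero_dimensional_space N"
  unfolding zero_dimensional_space_alt
proof (intro conjI allI impI)
  show "topspace N \<noteq> {}"
    using topspace_in_NC_star topspace_N by blast
  fix \<S> A assume SA: "openin N \<S> \<and> A \<in> \<S>"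
  then have A: "A \<in> NC_star X"
    using openin_subset topspace_N by blast
  from SA have "openin N \<S>" "A \<in> \<S>"
    by auto
  then show "\<exists>W. openin N W \<and> closedin N W \<and> A \<in> W \<and> W \<subseteq> \<S>"
  proof (rule N_clopen_basis[OF ad])
    fix F assume F: "finite F" "F \<subseteq> A" "\<And>x. x \<in> F \<Longrightarrow> branching x" "{B \<in> NC_star X. F \<subseteq> B} \<subseteq> \<S>"
    then show ?thesis
      using clopen_N_superset[OF F(1,3)] A by blast
  next
    fix F p q b assume F: "finite F" "F \<subseteq> A" "\<And>x. x \<in> F \<Longrightarrow> branching x"
      and pqb: "p \<in> A" "branching b" "b \<noteq> p" "b \<notin> A"
      and sub: "{B \<in> NC_star X. b \<notin> B \<and> B \<inter> branch b p \<noteq> {} \<and> F \<subseteq> B} \<subseteq> \<S>"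
    have "p \<in> topspace T"
      using pqb(1) A closedin_subset unfolding NC_star_iff by blast
    then have "p \<in> branch b p"
      using self_in_branch[of p b] pqb(3) by blast
    then have "A \<in> {B \<in> NC_star X. b \<notin> B \<and> B \<inter> branch b p \<noteq> {} \<and> F \<subseteq> B}"
      using A pqb F(2) by blast
    then show ?thesis
      using clopen_N_proper[OF F(1,3) pqb(2)] sub by blast
  qed
qed

text \<open>
  A basic clopen set consists of members that lie on the side of \<open>p\<close> of a branching point \<open>b\<close>. It is the
  union of the open sets of members that avoid some point \<open>c \<noteq> b\<close> of the arc from \<open>p\<close> to \<open>b\<close>, because a
  closed set containing all these \<open>c\<close> contains \<open>b\<close>. Cutting \<open>X\<close> at a point \<open>t\<close> close enough to \<open>b\<close>
  gives a member that contains any prescribed finite number of the points \<open>c\<close>, so there is no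
  finite subcover.
\<close>

theorem open_N_not_compact:
  assumes ad: "arcwise_dense_branching" and S: "openin N \<S>" "\<S> \<noteq> {}"
  shows "\<not> compactin N \<S>"
proof
  assume comp: "compactin N \<S>"
  obtain A0 where A0: "A0 \<in> \<S>"
    using S(2) by blast
  obtain A where A: "A \<in> \<S>" "A \<noteq> topspace T"
  proof (rule N_clopen_basis[OF ad S(1) A0])
    fix F assume F: "finite F" "F \<subseteq> A0" "A0 = topspace T" "{B \<in> NC_star X. F \<subseteq> B} \<subseteq> \<S>"
    obtain x y where xy: "x \<in> topspace T" "y \<in> topspace T" "x \<noteq> y"
      by (rule two_points)
    obtain p q where pq: "p \<in> topspace T" "q \<in> topspace T" "q \<noteq> p" "branch p q \<inter> F = {}"
      by (rule branch_avoiding_finite[OF ad F(1) _ xy]) (use F in auto)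
    show thesis
    proof (rule that)
      show "topspace T - branch p q \<in> \<S>"
        using complement_branch_in_NC_star[OF pq(1)] pq(4) F by blast
      show "topspace T - branch p q \<noteq> topspace T"
        using self_in_branch pq by blast
    qed
  next
    fix q assume "q \<in> topspace T" "q \<notin> A0"
    then show thesis
      using that[of A0] A0 by blast
  qed
  have AN: "A \<in> NC_star X"
    using A(1) S openin_subset topspace_N by blast
  show False
  proof (rule N_clopen_basis[OF ad S(1) A(1)])
    assume "A = topspace T"
    then show False
      using A(2) by blast
  next
    fix F p q b assume F: "finite F" "F \<subseteq> A" "\<And>x. x \<in> F \<Longrightarrow> branching x"
      and pqb: "p \<in> A" "q \<in> topspace T" "q \<notin> A" "A = topspace T - branch p q"
      "branching b" "b \<in> seg p q" "b \<noteq> p" "b \<noteq> q" "b \<notin> A"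
      and sub: "{B \<in> NC_star X. b \<notin> B \<and> B \<inter> branch b p \<noteq> {} \<and> F \<subseteq> B} \<subseteq> \<S>"
    let ?W = "{B \<in> NC_star X. b \<notin> B \<and> B \<inter> branch b p \<noteq> {} \<and> F \<subseteq> B}"
    have pX: "p \<in> topspace T" and bX: "b \<in> topspace T"
      using pqb(1) NC_star_subset[OF AN] branching_in_topspace[OF pqb(5)] by auto
    have compW: "compactin N ?W"
      using closed_compactin[OF comp sub clopen_N_proper(2)[OF F(1,3) pqb(5)]] .
    define \<O> where "\<O> = (\<lambda>c. {B \<in> NC_star X. c \<notin> B}) ` (seg p b - {b})"
    have "?W \<subseteq> \<Union>\<O>"
    proof
      fix B assume B: "B \<in> ?W"
      then have "openin T (topspace T - B)" "b \<in> topspace T - B"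
        using bX by (auto simp: NC_star_iff)
      then obtain t where "t \<in> seg b p" "t \<noteq> b" "seg b t \<subseteq> topspace T - B"
        by (rule seg_approach[OF bX pX pqb(7)])
      moreover from this have "t \<in> topspace T"
        using seg_subset_topspace by blast
      ultimately have "t \<in> seg p b - {b}" "t \<notin> B"
        using right_in_seg[of t b] seg_commute[of p b] by blast+
      then show "B \<in> \<Union>\<O>"
        using B unfolding \<O>_def by blast
    qed
    moreover have "openin N V" if "V \<in> \<O>" for V
      using that openin_N_avoid unfolding \<O>_def by auto
    ultimately obtain \<F> where \<F>: "finite \<F>" "\<F> \<subseteq> \<O>" "?W \<subseteq> \<Union>\<F>"
      using compactinD[OF compW, of \<O>] by blast
    obtain C where C: "C \<subseteq> seg p b - {b}" "finite C" "\<F> = (\<lambda>c. {B \<in> NC_star X. c \<notin> B}) ` C"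
      using finite_subset_image[OF \<F>(1) \<F>(2)[unfolded \<O>_def]] by blast
    have bseg: "b \<notin> seg p c" if c: "c \<in> C" for c
      using seg_antisym[OF bX pX, of c] c C(1) by (auto simp: seg_commute)
    have CX: "C \<subseteq> topspace T"
      using C(1) seg_subset_topspace by blast
    \<comment> \<open>a point of the arc in \<open>G\<close> lies beyond every \<open>c \<in> C\<close>, seen from \<open>p\<close>\<close>
    define G where "G = topspace T - \<Union>(seg p ` C)"
    have "openin T G"
      unfolding G_def using C(2) CX pX
      by (intro openin_diff closedin_Union) (auto intro: seg_closed_connected)
    moreover have "b \<in> G"
      unfolding G_def using bX bseg by blast
    ultimately obtain t where t: "t \<in> seg b p" "t \<noteq> b" "t \<noteq> p" "seg b t \<subseteq> G"
      by (rule seg_approach[OF bX pX pqb(7)])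
    have tX: "t \<in> topspace T"
      using t(1) seg_subset_topspace by blast
    then have tG: "t \<in> G"
      using t(4) right_in_seg[of t b] by blast
    let ?B = "topspace T - branch t b"
    have "c \<in> ?B" if c: "c \<in> C" for c
    proof -
      have "t \<notin> seg p c"
        using tG c unfolding G_def by blast
      then have "t \<in> seg b c"
        using t(1) seg_triangle[of b p c] by (auto simp: seg_commute)
      then show ?thesis
        using c CX by (auto simp: in_branch_iff)
    qed
    moreover have "?B \<in> ?W"
    proof -
      have "p \<in> ?B"
        using pX t(1) by (simp add: in_branch_iff)
      moreover have "p \<in> branch b p"
        using self_in_branch[of p b] pX pqb(7) by blast
      moreover have "b \<notin> ?B"
        using self_in_branch[OF bX] t(2)[symmetric] by blast
      moreover have "x \<in> ?B" if x: "x \<in> F" for x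
      proof -
        have xX: "x \<in> topspace T" and "p \<in> seg q x"
          using x F(2) pqb(4) by (auto simp: in_branch_iff)
        moreover have "p \<notin> seg q b"
          using seg_antisym[OF pX pqb(2) pqb(6,7)] by (simp add: seg_commute)
        ultimately have "p \<in> seg b x"
          using seg_triangle[of q x b] by blast
        then have "seg b p \<subseteq> seg b x"
          using seg_mono[OF bX xX, of b p] bX by simp
        then show ?thesis
          using t(1) xX by (auto simp: in_branch_iff)
      qed
      ultimately show ?thesis
        using complement_branch_in_NC_star[OF tX] by blast
    qed
    ultimately show False
      using \<F>(3) C(3) by blast
  qed
qed

section \<open>End points and branching points\<close>

lemma closedin_insert_branch:
  assumes "p \<in> topspace T"
  shows "closedin T (insert p (branch p q))"
  using openin_other_branches[of p q] assms branch_subset_topspace[of p q]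
  unfolding closedin_def by simp

lemma frontier_of_branch:
  assumes "p \<in> topspace T"
  shows "T frontier_of (branch p q) \<subseteq> {p}"
proof -
  have "T closure_of (branch p q) \<subseteq> insert p (branch p q)"
    by (intro closure_of_minimal closedin_insert_branch assms) auto
  then show ?thesis
    unfolding frontier_of_openin[OF openin_branch] by blast
qed

text \<open>
  Order zero is impossible: a proper nonempty open subset of a connected space has a boundary point.
\<close>

lemma end_pointI:
  assumes e: "e \<in> topspace T"
    and small: "\<And>U. openin T U \<Longrightarrow> e \<in> U \<Longrightarrow>
      \<exists>V b. openin T V \<and> e \<in> V \<and> V \<subseteq> U \<and> T frontier_of V \<subseteq> {b}"
  shows "e \<in> end_points T"
  unfolding end_points_def has_order_def
proof (intro CollectI conjI allI impI e)
  show "Card_order |{e}|"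
    by (rule card_of_Card_order)
  show "order_at_most T e |{e}|"
    unfolding order_at_most_def
  proof (intro allI impI)
    fix U assume "openin T U \<and> e \<in> U"
    then have "\<exists>V b. openin T V \<and> e \<in> V \<and> V \<subseteq> U \<and> T frontier_of V \<subseteq> {b}"
      by (intro small) auto
    then obtain V b where V: "openin T V" "e \<in> V" "V \<subseteq> U" "T frontier_of V \<subseteq> {b}"
      by blast
    have "inj_on (\<lambda>_. e) (T frontier_of V)"
      using V(4) by (auto simp: inj_on_def)
    then have "|T frontier_of V| \<le>o |{e}|"
      using card_of_ordLeq[of "T frontier_of V" "{e}"] by blast
    then show "\<exists>V. openin T V \<and> e \<in> V \<and> V \<subseteq> U \<and> |T frontier_of V| \<le>o |{e}|"
      using V by blast
  qed
next
  fix \<mu> :: "'a rel" assume "Card_order \<mu> \<and> order_at_most T e \<mu>"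
  then have \<mu>: "order_at_most T e \<mu>"
    by blast
  obtain y where y: "y \<in> topspace T" "y \<noteq> e"
    using two_points by metis
  have "openin T (topspace T - {y})"
    by (rule openin_minus_finite) simp
  moreover have "e \<in> topspace T - {y}"
    using e y by blast
  ultimately obtain V where V: "openin T V" "e \<in> V" "V \<subseteq> topspace T - {y}" "|T frontier_of V| \<le>o \<mu>"
    using \<mu> unfolding order_at_most_def by metis
  have "T frontier_of V \<noteq> {}"
  proof
    assume "T frontier_of V = {}"
    then have "closedin T V"
      using frontier_of_eq_empty[OF openin_subset[OF V(1)]] by blast
    then have "V = topspace T"
      using connected V(1,2) unfolding connected_space_clopen_in by blast
    then show False
      using V(3) y(1) by blast
  qed
  then obtain c where "c \<in> T frontier_of V"
    by blast
  then have "|{e}| \<le>o |T frontier_of V|"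
    using card_of_ordLeq[of "{e}" "T frontier_of V"] inj_on_def[of "\<lambda>_. c" "{e}"] by auto
  then show "|{e}| \<le>o \<mu>"
    using V(4) ordLeq_transitive by blast
qed

lemma end_pointD:
  assumes "e \<in> end_points T" "openin T U" "e \<in> U"
  obtains V where "openin T V" "e \<in> V" "V \<subseteq> U"
    "\<And>c c'. c \<in> T frontier_of V \<Longrightarrow> c' \<in> T frontier_of V \<Longrightarrow> c = c'"
proof -
  have "order_at_most T e |{e}|"
    using assms(1) unfolding end_points_def has_order_def by blast
  then obtain V where V: "openin T V" "e \<in> V" "V \<subseteq> U" "|T frontier_of V| \<le>o |{e}|"
    using assms(2,3) unfolding order_at_most_def by metis
  then obtain f where f: "inj_on f (T frontier_of V)" "f ` (T frontier_of V) \<subseteq> {e}"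
    using card_of_ordLeq[of "T frontier_of V" "{e}"] by blast
  have "c = c'" if "c \<in> T frontier_of V" "c' \<in> T frontier_of V" for c c'
  proof -
    have "f c = e" "f c' = e"
      using f(2) that by auto
    then show ?thesis
      using inj_onD[OF f(1)] that by metis
  qed
  with V show thesis
    using that by blast
qed

text \<open>
  Take an arc inside \<open>U\<close> and cover the compact set outside \<open>U\<close> by finitely many connected sets that miss
  the arc. A branch hanging off the arc that contains none of finitely many chosen points, one in
  each of these sets, is disjoint from all of them. Each chosen point spoils at most one branching
  point of the arc, namely the point at which it hangs off the arc itself.
\<close>

lemma branch_within_open:
  assumes ad: "arcwise_dense_branching" and U: "openin T U" "U \<noteq> {}"
  obtains b r where "b \<in> topspace T" "r \<in> topspace T" "r \<noteq> b" "branch b r \<subseteq> U"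
proof -
  obtain x where x: "x \<in> U"
    using U(2) by blast
  have xX: "x \<in> topspace T"
    using x U(1) openin_subset by blast
  obtain w where w: "w \<in> topspace T" "x \<noteq> w"
    using two_points by metis
  obtain y where y: "y \<in> seg x w" "y \<noteq> x" "y \<noteq> w" "seg x y \<subseteq> U"
    by (rule seg_approach[OF xX w U(1) x])
  have yX: "y \<in> topspace T"
    using y(1) seg_subset_topspace by blast
  let ?J = "seg x y"
  have J: "openin T (topspace T - ?J)"
    using seg_closed_connected(1)[OF xX yX] by blast
  define \<W> where "\<W> = {W. openin T W \<and> connectedin T W \<and> W \<subseteq> topspace T - ?J}"
  have cover: "\<exists>W\<in>\<W>. z \<in> W" if z: "z \<in> topspace T - U" for z
  proof -
    have "z \<in> topspace T - ?J"
      using z y(4) by blast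
    then show ?thesis
      using locally_connected J unfolding locally_connected_space \<W>_def by blast
  qed
  have "closedin T (topspace T - U)"
    using U(1) by blast
  then have "compactin T (topspace T - U)"
    using compact closedin_compact_space by blast
  moreover have "topspace T - U \<subseteq> \<Union>\<W>"
    using cover by blast
  moreover have "openin T W" if "W \<in> \<W>" for W
    using that unfolding \<W>_def by blast
  ultimately obtain \<F> where \<F>: "finite \<F>" "\<F> \<subseteq> \<W>" "topspace T - U \<subseteq> \<Union>\<F>"
    using compactinD[of T "topspace T - U" \<W>] by blast
  define f where "f W = (SOME w. w \<in> W)" for W :: "'a set"
  have f: "f W \<in> W" if "z \<in> W" for z W
    unfolding f_def using that by (rule someI)
  have fX: "f W \<in> topspace T" if "W \<in> \<F>" "z \<in> W" for W z
    using f[OF that(2)] that(1) \<F>(2) openin_subset unfolding \<W>_def by blast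
  \<comment> \<open>the branching points whose free branch could contain the chosen point of \<open>W\<close>\<close>
  define bad where "bad W = {b \<in> ?J. f W \<in> topspace T \<and> b \<in> seg (f W) x \<and> b \<in> seg (f W) y}" for W
  have "finite (bad W)" for W
  proof (cases "bad W = {}")
    case False
    then obtain b where b: "b \<in> bad W"
      by blast
    have "bad W \<subseteq> {b}"
      using median_unique[OF xX yX, of "f W"] b unfolding bad_def by blast
    then show ?thesis
      using finite_subset by blast
  qed simp
  then have fin: "finite (\<Union>(bad ` \<F>))"
    using \<F>(1) by blast
  have "openin T (topspace T - (\<Union>(bad ` \<F>) - {x}))"
    using fin by (intro openin_minus_finite) blast
  moreover have "x \<in> topspace T - (\<Union>(bad ` \<F>) - {x})"
    using xX by blast
  ultimately obtain b where b: "branching b" "b \<in> ?J" "b \<noteq> x" "b \<notin> \<Union>(bad ` \<F>)"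
    using branching_near[OF ad xX yX] y(2) by (metis DiffD2 DiffI singletonD)
  have bX: "b \<in> topspace T"
    using b(1) by (rule branching_in_topspace)
  obtain r where r: "r \<in> topspace T" "r \<noteq> b" "b \<in> seg r x" "b \<in> seg r y"
    by (rule third_branch[OF b(1) xX yX])
  have "branch b r \<subseteq> U"
  proof (rule ccontr)
    assume "\<not> branch b r \<subseteq> U"
    then obtain z where z: "z \<in> branch b r" "z \<notin> U"
      by blast
    then obtain W where W: "W \<in> \<F>" "z \<in> W"
      using \<F>(3) branch_subset_topspace by blast
    have "W \<subseteq> branch b z"
      using W \<F>(2) b(2) unfolding \<W>_def by (intro branch_superset) auto
    then have "f W \<in> branch b r"
      using f[OF W(2)] branch_trans[OF z(1)] by blast
    then have "b \<notin> seg r (f W)"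
      by (simp add: in_branch_iff)
    then have "b \<in> seg (f W) x" "b \<in> seg (f W) y"
      using r(3,4) seg_triangle[of r x "f W"] seg_triangle[of r y "f W"] by auto
    then have "b \<in> bad W"
      using b(2) fX[OF W] unfolding bad_def by blast
    then show False
      using b(4) W(1) by blast
  qed
  then show thesis
    using that bX r(1,2) by blast
qed

text \<open>
  Nested branches with diameters tending to zero shrink to a point with arbitrarily small neighbourhoods
  whose boundary is a single point.
\<close>

theorem arcwise_dense_branching_imp_end_points_dense:
  assumes ad: "arcwise_dense_branching"
  shows "T closure_of end_points T = topspace T"
proof -
  interpret M: Metric_space "mspace X" "mdist X"
    by simp
  have TM: "T = M.mtopology"
    unfolding mtopology_of_def ..
  have TX: "topspace T = mspace X"
    by (rule topspace_mtopology_of)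
  have "\<exists>e\<in>end_points T. e \<in> U" if U: "openin T U" "U \<noteq> {}" for U
  proof -
    let ?P = "\<lambda>V. openin T V \<and> V \<noteq> {} \<and> V \<subseteq> U"
    let ?Q = "\<lambda>n V V'. \<exists>b r x. b \<in> topspace T \<and> T closure_of V' \<subseteq> branch b r \<and> branch b r \<subseteq> V \<and>
        V' \<subseteq> M.mball x (inverse (real (Suc n)))"
    have step: "\<exists>V'. ?P V' \<and> ?Q n V V'" if V: "?P V" for V n
    proof -
      obtain b r where br: "b \<in> topspace T" "r \<in> topspace T" "r \<noteq> b" "branch b r \<subseteq> V"
        by (rule branch_within_open[OF ad]) (use V in auto)
      have "openin T (branch b r \<inter> M.mball r (inverse (real (Suc n))))"
        unfolding TM using openin_branch TM by (intro openin_Int) auto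
      moreover have "r \<in> branch b r \<inter> M.mball r (inverse (real (Suc n)))"
        using self_in_branch br(2,3) TX by auto
      ultimately obtain W where W: "openin T W" "r \<in> W"
        "T closure_of W \<subseteq> branch b r \<inter> M.mball r (inverse (real (Suc n)))"
        using small_connected_neighbourhood by metis
      moreover have "W \<subseteq> T closure_of W"
        using W(1) by (simp add: closure_of_subset openin_subset)
      ultimately show ?thesis
        using V br by (intro exI[of _ W]) blast
    qed
    have "\<exists>V. \<forall>n. ?P (V n) \<and> ?Q n (V n) (V (Suc n))"
      by (rule dependent_nat_choice) (use U step in auto)
    then obtain V where "\<forall>n. ?P (V n) \<and> ?Q n (V n) (V (Suc n))" ..
    then have V: "\<And>n. ?P (V n)" "\<And>n. ?Q n (V n) (V (Suc n))"
      by simp_all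
    \<comment> \<open>closures of the stages interlace with the stages, so their intersection lies in all branches\<close>
    define C where "C n = T closure_of (V n)" for n
    have VC: "V n \<subseteq> C n" for n
      unfolding C_def using V(1)[of n] by (simp add: closure_of_subset openin_subset)
    have CV: "C (Suc n) \<subseteq> V n" for n
      unfolding C_def using V(2)[of n] by blast
    have "(\<Inter>n. C n) \<noteq> {}"
    proof (rule compact_space_imp_nest[OF compact])
      show "closedin T (C n)" for n
        unfolding C_def by simp
      show "C n \<noteq> {}" for n
        using V(1)[of n] VC[of n] by blast
      show "decseq C"
        using CV VC by (intro decseq_SucI) blast
    qed
    then obtain e where e: "\<And>n. e \<in> C n"
      by blast
    have eU: "e \<in> U"
      using e[of "Suc 0"] CV[of 0] V(1)[of 0] by blast
    have "e \<in> end_points T"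
    proof (rule end_pointI)
      show "e \<in> topspace T"
        using eU U(1) openin_subset by blast
      fix G assume G: "openin T G" "e \<in> G"
      obtain d where d: "d > 0" "M.mball e d \<subseteq> G"
        using G unfolding TM M.openin_mtopology by blast
      obtain n where n: "inverse (real (Suc n)) < d / 2"
        using reals_Archimedean[of "d / 2"] d(1) by auto
      obtain x where x: "V (Suc n) \<subseteq> M.mball x (inverse (real (Suc n)))"
        using V(2)[of n] by blast
      obtain b r where br: "b \<in> topspace T" "C (Suc (Suc n)) \<subseteq> branch b r" "branch b r \<subseteq> V (Suc n)"
        using V(2)[of "Suc n"] unfolding C_def by blast
      have "e \<in> branch b r"
        using e br(2) by blast
      moreover have "branch b r \<subseteq> G"
      proof
        fix z assume "z \<in> branch b r"
        then have "z \<in> M.mball x (inverse (real (Suc n)))" "e \<in> M.mball x (inverse (real (Suc n)))"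
          using \<open>e \<in> branch b r\<close> br(3) x by auto
        then have "mdist X e z < d" "e \<in> mspace X" "z \<in> mspace X"
          using M.triangle[of e x z] M.commute[of e x] n by auto
        then show "z \<in> G"
          using d(2) by auto
      qed
      moreover have "T frontier_of (branch b r) \<subseteq> {b}"
        by (rule frontier_of_branch[OF br(1)])
      ultimately show "\<exists>V b. openin T V \<and> e \<in> V \<and> V \<subseteq> G \<and> T frontier_of V \<subseteq> {b}"
        using openin_branch by blast
    qed
    then show ?thesis
      using eU by blast
  qed
  then show ?thesis
    by (auto simp: closure_of_def)
qed

text \<open>
  A point near an interior point of the arc that is not on the arc hangs off it at some median. Were the
  interior free of branching points, the median would be an end of the arc, hence not nearby; so the
  interior is open and contains an end point \<open>e\<close>. Both halves of the arc leave a small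
  neighbourhood of \<open>e\<close> through its boundary, which consists of one point, and \<open>e\<close> is the only
  common point of the halves.
\<close>

theorem end_points_dense_imp_arcwise_dense_branching:
  assumes dense: "T closure_of end_points T = topspace T"
  shows "arcwise_dense_branching"
  unfolding arcwise_dense_branching_def
proof (intro ballI impI)
  fix x y assume x: "x \<in> topspace T" and y: "y \<in> topspace T" and xy: "x \<noteq> y"
  show "\<exists>b\<in>seg x y. b \<noteq> x \<and> b \<noteq> y \<and> branching b"
  proof (rule ccontr)
    assume none: "\<not> (\<exists>b\<in>seg x y. b \<noteq> x \<and> b \<noteq> y \<and> branching b)"
    have openX: "openin T (topspace T - {x, y})"
      by (rule openin_minus_finite) simp
    let ?I = "seg x y - {x, y}"
    have "\<exists>W. openin T W \<and> t \<in> W \<and> W \<subseteq> ?I" if t: "t \<in> ?I" for t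
    proof -
      have "t \<in> topspace T - {x, y}"
        using t seg_subset_topspace by blast
      then obtain W where W: "openin T W" "connectedin T W" "t \<in> W" "W \<subseteq> topspace T - {x, y}"
        using locally_connected openX unfolding locally_connected_space by metis
      have "w \<in> seg x y" if w: "w \<in> W" for w
      proof (rule ccontr)
        assume out: "w \<notin> seg x y"
        have wX: "w \<in> topspace T"
          using w W(4) by blast
        obtain m where m: "m \<in> seg x y" "m \<in> seg w x" "m \<in> seg w y"
          by (rule median[OF x y wX])
        have wt: "seg w t \<subseteq> W"
          by (rule seg_subset[OF W(2) w W(3)])
        have tX: "t \<in> topspace T"
          using W(3,4) by blast
        have "m \<noteq> x"
        proof
          assume "m = x"
          then have "x \<in> seg w t \<union> seg t y"
            using m(3) seg_triangle[of w y t] by blast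
          moreover have "x \<notin> seg t y"
            using seg_antisym[OF x y, of t] t by blast
          ultimately show False
            using wt W(4) by blast
        qed
        moreover have "m \<noteq> y"
        proof
          assume "m = y"
          then have "y \<in> seg w t \<union> seg t x"
            using m(2) seg_triangle[of w x t] by blast
          moreover have "y \<notin> seg t x"
            using seg_antisym[OF y x, of t] t by (auto simp: seg_commute)
          ultimately show False
            using wt W(4) by blast
        qed
        moreover have "m \<noteq> w"
          using out m(1) by blast
        ultimately have "branching m"
          unfolding branching_def using m x y wX
          by (intro bexI[of _ x] bexI[of _ y] bexI[of _ w]) (auto simp: seg_commute)
        then show False
          using none m(1) \<open>m \<noteq> x\<close> \<open>m \<noteq> y\<close> by blast
      qed
      then show ?thesis
        using W by blast
    qed
    then have "openin T ?I"
      by (subst openin_subopen) blast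
    moreover obtain t where "t \<in> ?I"
      by (rule seg_approach[OF x y xy openin_topspace x]) blast
    moreover have "t \<in> T closure_of end_points T"
      using \<open>t \<in> ?I\<close> dense seg_subset_topspace by blast
    ultimately have "\<exists>e. e \<in> end_points T \<and> e \<in> ?I"
      unfolding in_closure_of by meson
    then obtain e where e: "e \<in> end_points T" "e \<in> ?I"
      by blast
    obtain V where V: "openin T V" "e \<in> V" "V \<subseteq> ?I"
      "\<And>c c'. c \<in> T frontier_of V \<Longrightarrow> c' \<in> T frontier_of V \<Longrightarrow> c = c'"
      by (rule end_pointD[OF e(1) \<open>openin T ?I\<close> e(2)]) (rule that)
    have eX: "e \<in> topspace T"
      using V(1,2) openin_subset by blast
    have cross: "seg u e \<inter> T frontier_of V \<noteq> {}" if "u \<in> {x, y}" for u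
    proof (rule connectedin_Int_frontier_of)
      have uX: "u \<in> topspace T"
        using that x y by blast
      show "connectedin T (seg u e)"
        by (rule seg_closed_connected(2)[OF uX eX])
      show "seg u e \<inter> V \<noteq> {}"
        using V(2) right_in_seg[OF eX, of u] by blast
      show "seg u e - V \<noteq> {}"
        using V(3) that uX left_in_seg[OF uX, of e] by blast
    qed
    obtain c c' where c: "c \<in> seg x e" "c \<in> T frontier_of V" "c' \<in> seg y e" "c' \<in> T frontier_of V"
      using cross[of x] cross[of y] by blast
    have "c = c'"
      using V(4) c by blast
    then have "c = e"
      using seg_Int[OF x y, of e] e(2) c(1,3) by (auto simp: seg_commute)
    then show False
      using c(2) V(1,2) frontier_of_openin by blast
  qed
qed

section \<open>An arc without branching points gives a connected subspace\<close>

lemma continuous_map_into_N: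
  assumes f: "f \<in> topspace S \<rightarrow> NC_star X"
    and upper: "\<And>U. openin T U \<Longrightarrow> openin S {s \<in> topspace S. f s \<subseteq> U}"
    and hit: "\<And>U. openin T U \<Longrightarrow> openin S {s \<in> topspace S. f s \<inter> U \<noteq> {}}"
  shows "continuous_map S N f"
  unfolding continuous_map_def
proof (intro conjI allI impI)
  show "f \<in> topspace S \<rightarrow> topspace N"
    using f topspace_N by simp
  fix \<S> assume S: "openin N \<S>"
  have "\<exists>O'. openin S O' \<and> s \<in> O' \<and> O' \<subseteq> {s \<in> topspace S. f s \<in> \<S>}" if s: "s \<in> topspace S" "f s \<in> \<S>" for s
  proof -
    obtain U \<V> where UV: "openin T U" "finite \<V>" "\<And>V. V \<in> \<V> \<Longrightarrow> openin T V"
      "f s \<subseteq> U" "\<And>V. V \<in> \<V> \<Longrightarrow> f s \<inter> V \<noteq> {}"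
      "{B \<in> NC_star X. B \<subseteq> U \<and> (\<forall>V\<in>\<V>. B \<inter> V \<noteq> {})} \<subseteq> \<S>"
      by (rule N_basic_neighbourhood[OF S s(2)]) (rule that)
    define O' where "O' = \<Inter>(insert {s \<in> topspace S. f s \<subseteq> U} ((\<lambda>V. {s \<in> topspace S. f s \<inter> V \<noteq> {}}) ` \<V>))"
    have "openin S O'"
      unfolding O'_def using UV(1-3) upper hit by (intro openin_Inter) auto
    moreover have "s \<in> O'"
      unfolding O'_def using s(1) UV(4,5) by auto
    moreover have "f u \<in> \<S>" "u \<in> topspace S" if "u \<in> O'" for u
    proof -
      have u: "u \<in> topspace S" "f u \<subseteq> U" "\<forall>V\<in>\<V>. f u \<inter> V \<noteq> {}"
        using that unfolding O'_def by auto
      then have "f u \<in> NC_star X"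
        using f by blast
      then show "f u \<in> \<S>" "u \<in> topspace S"
        using u UV(6) by auto
    qed
    ultimately show ?thesis
      by blast
  qed
  then show "openin S {s \<in> topspace S. f s \<in> \<S>}"
    by (subst openin_subopen) blast
qed

text \<open>
  For \<open>t\<close> strictly inside an arc from \<open>x\<close> to \<open>y\<close> let \<open>\<phi> t\<close> be \<open>X\<close> minus the branch towards \<open>y\<close> at the
  point with parameter \<open>t\<close>. Upper semicontinuity of \<open>\<phi>\<close> always holds; lower semicontinuity could fail
  only at a parameter where a third branch is attached.
\<close>

theorem totally_disconnected_imp_arcwise_dense_branching:
  assumes td: "totally_disconnected_space N"
  shows "arcwise_dense_branching"
  unfolding arcwise_dense_branching_def
proof (intro ballI impI)
  fix x y assume x: "x \<in> topspace T" and y: "y \<in> topspace T" and xy: "x \<noteq> y"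
  show "\<exists>b\<in>seg x y. b \<noteq> x \<and> b \<noteq> y \<and> branching b"
  proof (rule ccontr)
    assume none: "\<not> (\<exists>b\<in>seg x y. b \<noteq> x \<and> b \<noteq> y \<and> branching b)"
    obtain g where g: "g 0 = x" "g 1 = y" "inj_on g {0..1::real}" "continuous_map (top_of_set {0..1}) T g"
      "\<And>s t. 0 \<le> s \<Longrightarrow> s \<le> t \<Longrightarrow> t \<le> 1 \<Longrightarrow> seg (g s) (g t) = g ` {s..t}"
      by (rule seg_parametrization[OF x y xy]) (rule that)
    let ?I = "{0<..<1::real}"
    define \<phi> where "\<phi> t = topspace T - branch (g t) y" for t
    have gI: "g t \<in> topspace T" "g t \<in> seg x y" "g t \<noteq> x" "g t \<noteq> y" if "t \<in> ?I" for t
    proof -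
      have "g t \<in> g ` {0..1}"
        using that by auto
      then show "g t \<in> seg x y"
        using g(5)[of 0 1] g(1,2) by simp
      then show "g t \<in> topspace T"
        using seg_subset_topspace by blast
      show "g t \<noteq> x" "g t \<noteq> y"
        using inj_onD[OF g(3), of t 0] inj_onD[OF g(3), of t 1] that g(1,2) by auto
    qed
    have contg: "continuous_map (top_of_set ?I) T g"
      by (rule continuous_map_from_subtopology_mono[OF g(4)]) auto
    have pre: "openin (top_of_set ?I) {t \<in> ?I. g t \<in> G}" if "openin T G" for G
      using contg that by (auto simp: continuous_map_def)
    have "continuous_map (top_of_set ?I) N \<phi>"
    proof (rule continuous_map_into_N)
      show "\<phi> \<in> topspace (top_of_set ?I) \<rightarrow> NC_star X"
        unfolding \<phi>_def using gI(1) complement_branch_in_NC_star by auto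
    next
      fix U assume U: "openin T U"
      have "\<exists>O'. openin (top_of_set ?I) O' \<and> t \<in> O' \<and> O' \<subseteq> {t \<in> ?I. \<phi> t \<subseteq> U}" if t: "t \<in> ?I" "\<phi> t \<subseteq> U" for t
      proof -
        have "closedin T (topspace T - U)"
          using U by blast
        moreover have "g t \<notin> seg z y" if "z \<in> topspace T - U" for z
          using that t(2) unfolding \<phi>_def by (auto simp: in_branch_iff seg_commute)
        ultimately obtain G where G: "openin T G" "g t \<in> G"
          "\<And>b z. b \<in> G \<Longrightarrow> z \<in> topspace T - U \<Longrightarrow> b \<notin> seg z y"
          using seg_avoid_neighbourhood[of "topspace T - U" "g t" y] gI(1)[OF t(1)] y by metis
        have "\<phi> s \<subseteq> U" if "g s \<in> G" for s
        proof
          fix z assume "z \<in> \<phi> s"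
          then have "z \<in> topspace T" "g s \<in> seg z y"
            unfolding \<phi>_def by (auto simp: in_branch_iff seg_commute)
          then show "z \<in> U"
            using G(3)[OF that, of z] by blast
        qed
        then show ?thesis
          using pre[OF G(1)] t(1) G(2) by (intro exI[of _ "{t \<in> ?I. g t \<in> G}"]) auto
      qed
      then show "openin (top_of_set ?I) {s \<in> topspace (top_of_set ?I). \<phi> s \<subseteq> U}"
        by (subst openin_subopen) simp
    next
      fix U assume U: "openin T U"
      have "\<exists>O'. openin (top_of_set ?I) O' \<and> t \<in> O' \<and> O' \<subseteq> {t \<in> ?I. \<phi> t \<inter> U \<noteq> {}}"
        if t: "t \<in> ?I" "\<phi> t \<inter> U \<noteq> {}" for t
      proof -
        obtain z where z: "z \<in> topspace T" "z \<in> U" "g t \<in> seg y z"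
          using t(2) unfolding \<phi>_def by (auto simp: in_branch_iff)
        show ?thesis
        proof (cases "z = g t")
          case True
          have "g s \<in> \<phi> s" if "s \<in> ?I" for s
            using gI(1)[OF that] unfolding \<phi>_def by auto
          then show ?thesis
            using pre[OF U] t(1) z(2) True by (intro exI[of _ "{t \<in> ?I. g t \<in> U}"]) auto
        next
          case False
          have out: "g t \<notin> seg z x"
          proof
            assume "g t \<in> seg z x"
            then have "branching (g t)"
              unfolding branching_def using gI[OF t(1)] x y z False
              by (intro bexI[of _ x] bexI[of _ y] bexI[of _ z]) auto
            then show False
              using none gI[OF t(1)] by blast
          qed
          let ?G = "topspace T - seg z x"
          have "openin T ?G"
            using seg_closed_connected(1)[OF z(1) x] by blast
          moreover have "z \<in> \<phi> s" if "s \<in> ?I" "g s \<in> ?G" for s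
            using gI(2)[OF that(1)] that(2) seg_triangle[of x y z] z(1) unfolding \<phi>_def
            by (auto simp: in_branch_iff seg_commute)
          ultimately show ?thesis
            using pre[of ?G] t(1) z(2) out gI(1)[OF t(1)] by (intro exI[of _ "{t \<in> ?I. g t \<in> ?G}"]) auto
        qed
      qed
      then show "openin (top_of_set ?I) {s \<in> topspace (top_of_set ?I). \<phi> s \<inter> U \<noteq> {}}"
        by (subst openin_subopen) simp
    qed
    moreover have "connectedin (top_of_set ?I) ?I"
      by (simp add: connectedin_subtopology)
    ultimately have conn: "connectedin N (\<phi> ` ?I)"
      by (rule connectedin_continuous_map_image)
    have I: "1/3 \<in> ?I" "2/3 \<in> ?I"
      by auto
    have "g (2/3) \<in> \<phi> (2/3)"
      using gI(1)[OF I(2)] unfolding \<phi>_def by auto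
    moreover have "g (2/3) \<notin> \<phi> (1/3)"
    proof -
      have "seg (g (2/3)) y = g ` {2/3..1}"
        using g(5)[of "2/3" 1] g(2) by simp
      moreover have "g (1/3) \<notin> g ` {2/3..1}"
      proof
        assume "g (1/3) \<in> g ` {2/3..1}"
        then obtain s where "s \<in> {2/3..1}" "g (1/3) = g s"
          by blast
        then show False
          using inj_onD[OF g(3), of "1/3" s] by auto
      qed
      ultimately show ?thesis
        using gI(1)[OF I(2)] unfolding \<phi>_def by (simp add: in_branch_iff seg_commute)
    qed
    ultimately have "\<phi> (1/3) \<noteq> \<phi> (2/3)"
      by metis
    moreover have \<phi>N: "\<phi> (1/3) \<in> topspace N" "\<phi> (2/3) \<in> topspace N"
      using I connectedin_subset_topspace[OF conn] by blast+
    ultimately obtain \<U> where U: "openin N \<U>" "closedin N \<U>" "\<phi> (1/3) \<in> \<U>" "\<phi> (2/3) \<notin> \<U>"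
      using td unfolding totally_disconnected_space_def by metis
    have "openin N (topspace N - \<U>)"
      using U(2) by blast
    then show False
      using connectedinD[OF conn U(1), of "topspace N - \<U>"] U(3,4) \<phi>N I
        connectedin_subset_topspace[OF conn] by blast
  qed
qed

section \<open>Polishness and the equivalence\<close>

lemma second_countable_N: "second_countable N"
proof -
  interpret H: Metric_space "mspace (continuum_hyperspace X)" "mdist (continuum_hyperspace X)"
    by simp
  have "second_countable (mtopology_of (continuum_hyperspace X))"
    using H.compact_space_imp_second_countable compact_space_hyperspace[OF continuum]
    unfolding mtopology_of_def by blast
  then show ?thesis
    unfolding NC_star_space_def by (rule second_countable_subtopology)
qed

text \<open>
  Components of the complement are open, so disconnectedness of the complement is witnessed by two
  points of any dense set whose arc runs through \<open>A\<close>.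
\<close>

lemma NC_star_iff_seg:
  assumes Q: "Q \<subseteq> topspace T" "T closure_of Q = topspace T" and A: "A \<in> subcontinua T"
  shows "A \<in> NC_star X \<longleftrightarrow> (\<forall>x\<in>Q. \<forall>y\<in>Q. x \<in> A \<or> y \<in> A \<or> seg x y \<inter> A = {})"
proof
  assume "A \<in> NC_star X"
  then have "connectedin T (topspace T - A)"
    using NC_star_iff by blast
  then have "seg x y \<subseteq> topspace T - A" if "x \<in> topspace T - A" "y \<in> topspace T - A" for x y
    using seg_subset that by blast
  then show "\<forall>x\<in>Q. \<forall>y\<in>Q. x \<in> A \<or> y \<in> A \<or> seg x y \<inter> A = {}"
    using Q(1) by blast
next
  assume seg: "\<forall>x\<in>Q. \<forall>y\<in>Q. x \<in> A \<or> y \<in> A \<or> seg x y \<inter> A = {}"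
  have cA: "closedin T A"
    using A unfolding subcontinua_def by blast
  have "connectedin T (topspace T - A)"
  proof (rule ccontr)
    assume "\<not> connectedin T (topspace T - A)"
    then obtain E1 E2 where E: "openin T E1" "openin T E2" "topspace T - A \<subseteq> E1 \<union> E2"
      "E1 \<inter> E2 \<inter> (topspace T - A) = {}" "E1 \<inter> (topspace T - A) \<noteq> {}" "E2 \<inter> (topspace T - A) \<noteq> {}"
      unfolding connectedin by blast
    have dense: "\<exists>q\<in>Q. q \<in> G" if G: "openin T G" "G \<noteq> {}" for G
    proof -
      obtain z where z: "z \<in> G"
        using G(2) by blast
      then have "z \<in> T closure_of Q"
        using openin_subset[OF G(1)] Q(2) by blast
      then show ?thesis
        using G(1) z unfolding in_closure_of by metis
    qed
    have "openin T (E1 \<inter> (topspace T - A))" "openin T (E2 \<inter> (topspace T - A))"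
      using E(1,2) cA by (auto intro!: openin_Int)
    from dense[OF this(1) E(5)] dense[OF this(2) E(6)]
    obtain x y where xy: "x \<in> Q" "x \<in> E1" "x \<notin> A" "y \<in> Q" "y \<in> E2" "y \<notin> A"
      by blast
    have xyX: "x \<in> topspace T" "y \<in> topspace T"
      using xy Q(1) by auto
    have "seg x y \<subseteq> topspace T - A"
      using seg xy seg_subset_topspace by blast
    moreover have "connectedin T (seg x y)"
      by (rule seg_closed_connected(2)[OF xyX])
    moreover have "x \<in> seg x y" "y \<in> seg x y"
      using xyX by auto
    ultimately show False
      using connectedinD[of T "seg x y" E1 E2] E(1-4) xy(2,5) by blast
  qed
  then show "A \<in> NC_star X"
    using A unfolding NC_star_iff subcontinua_def by blast
qed

text \<open>
  For a fixed pair of points the condition of \<open>NC_star_iff_seg\<close> is a union of two closed sets and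
  an open one, and a countable dense set gives countably many pairs.
\<close>

theorem completely_metrizable_N: "completely_metrizable_space N"
proof -
  interpret M: Metric_space "mspace X" "mdist X"
    by simp
  let ?H = "mtopology_of (continuum_hyperspace X)"
  let ?C = "subcontinua T"
  have topH: "topspace ?H = ?C"
    unfolding topspace_mtopology_of by (rule mspace_continuum_hyperspace[OF continuum])
  have metH: "metrizable_space ?H"
    using Metric_space.metrizable_space_mtopology[OF Metric_space_mspace_mdist]
    unfolding mtopology_of_def .
  have "second_countable T"
    using M.compact_space_imp_second_countable compact unfolding mtopology_of_def by blast
  then have "separable_space T"
    by (rule second_countable_imp_separable_space)
  then obtain Q where Q: "countable Q" "Q \<subseteq> topspace T" "T closure_of Q = topspace T"
    unfolding separable_space_def by blast
  have subT: "A \<subseteq> topspace T" if "A \<in> ?C" for A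
    using that closedin_subset unfolding subcontinua_def by blast
  define G where "G = (\<lambda>(x, y). {A \<in> ?C. x \<in> A \<or> y \<in> A \<or> seg x y \<inter> A = {}})"
  have contains: "closedin ?H {A \<in> ?C. x \<in> A}" for x
  proof -
    have "openin T (topspace T - {x})"
      by (rule openin_minus_finite) simp
    then have "closedin ?H (topspace ?H - {A \<in> ?C. A \<subseteq> topspace T - {x}})"
      by (intro closedin_diff closedin_topspace openin_hyperspace_upper[OF continuum])
    moreover have "topspace ?H - {A \<in> ?C. A \<subseteq> topspace T - {x}} = {A \<in> ?C. x \<in> A}"
      unfolding topH using subT by blast
    ultimately show ?thesis
      by simp
  qed
  have "gdelta_in ?H (G (x, y))" if "x \<in> topspace T" "y \<in> topspace T" for x y
  proof -
    have "openin T (topspace T - seg x y)"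
      using seg_closed_connected(1)[OF that] by blast
    then have "openin ?H {A \<in> ?C. A \<subseteq> topspace T - seg x y}"
      by (rule openin_hyperspace_upper[OF continuum])
    moreover have "G (x, y) = {A \<in> ?C. x \<in> A} \<union> {A \<in> ?C. y \<in> A} \<union> {A \<in> ?C. A \<subseteq> topspace T - seg x y}"
      unfolding G_def using subT by auto
    ultimately show ?thesis
      using contains metH by (simp add: gdelta_in_Un closed_imp_gdelta_in open_imp_gdelta_in)
  qed
  then have "gdelta_in ?H (\<Inter>(insert ?C (G ` (Q \<times> Q))))"
    using Q(1,2) gdelta_in_topspace[of ?H] unfolding topH
    by (intro gdelta_in_Inter) auto
  moreover have "\<Inter>(insert ?C (G ` (Q \<times> Q))) = NC_star X"
  proof -
    have "A \<in> \<Inter>(insert ?C (G ` (Q \<times> Q))) \<longleftrightarrow> A \<in> NC_star X" if "A \<in> ?C" for A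
      unfolding NC_star_iff_seg[OF Q(2,3) that] G_def using that by auto
    moreover have "NC_star X \<subseteq> ?C"
      unfolding NC_star_def by blast
    ultimately show ?thesis
      by blast
  qed
  ultimately have "gdelta_in ?H (NC_star X)"
    by simp
  moreover have "completely_metrizable_space ?H"
    using metH compact_space_hyperspace[OF continuum] compact_imp_locally_compact_space
      locally_compact_imp_completely_metrizable_space by blast
  ultimately show ?thesis
    unfolding NC_star_space_def by (rule completely_metrizable_space_gdelta_in[rotated])
qed

theorem N_homeomorphic_irrationals:
  assumes "arcwise_dense_branching"
  shows "N homeomorphic_space top_of_set (UNIV - \<rat> :: real set)"
proof -
  have "N homeomorphic_space baire_space"
    using open_N_not_compact[OF assms]
    by (intro homeomorphic_baire_space completely_metrizable_N second_countable_N zero_dimensional_N assms)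
  then show ?thesis
    using irrationals_homeomorphic_baire_space homeomorphic_space_sym homeomorphic_space_trans by blast
qed

end

theorem corollary5p10:
  fixes X :: "'a metric"
  assumes "dendrite X"
  shows "(mtopology_of X closure_of end_points (mtopology_of X) = mspace X
            \<longleftrightarrow> NC_star_space X homeomorphic_space top_of_set (UNIV - \<rat> :: real set)) \<and>
         (NC_star_space X homeomorphic_space top_of_set (UNIV - \<rat> :: real set)
            \<longleftrightarrow> zero_dimensional_space (NC_star_space X)) \<and>
         (zero_dimensional_space (NC_star_space X)
            \<longleftrightarrow> totally_disconnected_space (NC_star_space X))"
proof -
  interpret metric_dendrite X
    by unfold_locales (rule assms)
  let ?a = "T closure_of end_points T = mspace X"
  let ?b = "N homeomorphic_space top_of_set (UNIV - \<rat> :: real set)"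
  have TX: "topspace T = mspace X"
    by (rule topspace_mtopology_of)
  have ab: "?b" if ?a
    using that TX N_homeomorphic_irrationals end_points_dense_imp_arcwise_dense_branching by simp
  have bc: "zero_dimensional_space N" if ?b
    using that zero_dimensional_irrationals zero_dimensional_space_homeomorphic by blast
  have "t1_space N"
    using completely_metrizable_N completely_metrizable_imp_metrizable_space metrizable_imp_t1_space by blast
  then have cd: "totally_disconnected_space N" if "zero_dimensional_space N"
    using that zero_dimensional_imp_totally_disconnected_space by blast
  have da: ?a if "totally_disconnected_space N"
    using that TX arcwise_dense_branching_imp_end_points_dense
      totally_disconnected_imp_arcwise_dense_branching by simp
  show ?thesis
    using ab bc cd da by blast
qed

end
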